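(* Let $C$ be a curve on a surface $M\subset S^3$ and let $\mathrm{Cansec}(C)\subset V(M)\subset\Lambda^4$ be its canonical section. The curve $C$ is a Darboux curve if and only if the section $\mathrm{Cansec}(C)\subset V(M)$ is a geodesic in $V(M)$. This happens if and only if the curve $C\subset M$ satisfies the equation $$k_n'+\tau_g\,k_g=0,$$ where $k_n$, $k_g$, $\tau_g$ are the normal curvature, the geodesic curvature and the geodesic torsion of $C\subset M$, and $'$ denotes the derivative with respect to the arc length of $C$.
   Context: Lorentz model. On $\mathbb R^5$ let $\mathcal L(u,v)=-u_0v_0+u_1v_1+\dots+u_4v_4$ and $\mathcal L(v)=\mathcal L(v,v)$. Put $\Lambda^4=\{\mathcal L=1\}$ and let $S^3=\{\mathcal L=0\}\cap\{x_0=1\}$ with the round metric induced by $\mathcal L$. Oriented 2-spheres $\Sigma\subset S^3$ correspond to points $\sigma\in\Lambda^4$ by $\Sigma=\sigma^{\perp}\cap S^3$; if $m\in\Sigma$, $n$ is the unit vector tangent to $S^3$ and normal to $\Sigma$ at $m$, and $k$ is the geodesic curvature of $\Sigma$, then $\sigma=k\,m+n$. $V(M)$. For a surface $M\subset S^3$ with unit normal $n$ and principal curvatures $k_1,k_2$, $V(M)\subset\Lambda^4$ is the set of spheres having a saddle contact with $M$ together with the osculating spheres, i.e. the points $k\,m+n(m)$ with $m\in M$ and $k$ in the closed interval between $k_1(m)$ and $k_2(m)$. It carries the degenerate metric induced by $\mathcal L$; the normal (and kernel) direction at $km+n$ is spanned by the light-like vector $m$. Canonical section. $\mathrm{Cansec}(C)$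 is the curve $m\mapsto\sigma(m)=k_n(m)\,m+n(m)$, $m\in C$, where $k_n(m)$ is the normal curvature of $M$ in the direction tangent to $C$. Where $C$ is not tangent to a principal direction, $\sigma(m)$ is the sphere tangent to $M$ at $m$ such that one branch of its intersection with $M$ is tangent to $C$ at $m$; where $C$ is tangent to a principal direction, it is the corresponding osculating sphere of $M$ (the sphere tangent to $M$ with the corresponding principal curvature). Darboux frame. $T$ is the unit tangent of $C$, $N_1$ the unit vector tangent to $M$ and normal to $C$ compatible with the orientation; $\nabla_TT=k_gN_1+k_nn$ and $\langle\nabla_Tn,N_1\rangle=-\tau_g$. Geodesic. For a space-like curve $\sigma$ in $\Lambda^4$ parametrized by arc length (for $\mathcal L$), the geodesic curvature vector is $\ddot\sigma+\sigma$. The curve is a geodesic in a submanifold of $\Lambda^4$ containing it if this vector is $\mathcal L$-orthogonal to the submanifold. Darboux curve. A curve on $M$ such that at each point its osculating sphere (the sphere having contact of order at least 3 with the curve) is tangent to $M$.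
   Formalization: The equivalence with Cansec(C) being a geodesic is stated on open arcs of C where Cansec(C) is space-like (C not tangent to a principal direction), since geodesics are defined only for space-like curves; the equivalence of Darboux curves with the equation is unrestricted. *)

theory Defs
  imports "HOL-Analysis.Analysis"
begin

subsection \<open>Smooth maps and tangent spaces\<close>

text \<open>
  Meant for open \<open>S\<close>.  In finite dimensions, continuity of all directional derivatives together
  with differentiability is the usual notion of class $C^k$.
\<close>
fun Ck_on :: "nat \<Rightarrow> ('a::real_normed_vector \<Rightarrow> 'b::real_normed_vector) \<Rightarrow> 'a set \<Rightarrow> bool" where
  "Ck_on 0 f S \<longleftrightarrow> continuous_on S f"
| "Ck_on (Suc k) f S \<longleftrightarrow>
     (\<forall>x\<in>S. f differentiable (at x)) \<and>
     (\<forall>v. Ck_on k (\<lambda>x. frechet_derivative f (at x) v) S)"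

definition smooth_on :: "('a::real_normed_vector \<Rightarrow> 'b::real_normed_vector) \<Rightarrow> 'a set \<Rightarrow> bool" where
  "smooth_on f S \<longleftrightarrow> (\<forall>k. Ck_on k f S)"

definition smooth_map_on_set ::
    "('a::real_normed_vector \<Rightarrow> 'b::real_normed_vector) \<Rightarrow> 'a set \<Rightarrow> bool" where
  "smooth_map_on_set f M \<longleftrightarrow>
     (\<forall>p\<in>M. \<exists>U g. open U \<and> p \<in> U \<and> smooth_on g U \<and> (\<forall>x \<in> M \<inter> U. g x = f x))"

text \<open>Velocities of curves lying in \<open>S\<close>; for a submanifold this is its tangent space.\<close>
definition tangent_space :: "'a::real_normed_vector set \<Rightarrow> 'a \<Rightarrow> 'a set" where
  "tangent_space S p =
     {v. \<exists>\<gamma>. \<gamma> 0 = p \<and> (\<forall>\<^sub>F s in nhds (0::real). \<gamma> s \<in> S) \<and> (\<gamma> has_vector_derivative v) (at 0)}"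


subsection \<open>The Lorentz model\<close>

text \<open>In the numeral type \<open>5\<close> the index \<open>5\<close> is \<open>0\<close>; the indices used are \<open>0, 1, 2, 3, 4\<close>.\<close>
definition lor :: "real^5 \<Rightarrow> real^5 \<Rightarrow> real" where
  "lor u v = - (u $ 0 * v $ 0) + u $ 1 * v $ 1 + u $ 2 * v $ 2 + u $ 3 * v $ 3 + u $ 4 * v $ 4"

definition Lambda4 :: "(real^5) set" where
  "Lambda4 = {v. lor v v = 1}"

definition S3 :: "(real^5) set" where
  "S3 = {x. lor x x = 0 \<and> x $ 0 = 1}"

definition sphere_of :: "real^5 \<Rightarrow> (real^5) set" where
  "sphere_of \<sigma> = {x \<in> S3. lor \<sigma> x = 0}"


subsection \<open>Surfaces in the 3-sphere\<close>

definition smooth_surface :: "(real^5) set \<Rightarrow> bool" where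
  "smooth_surface M \<longleftrightarrow>
     M \<subseteq> S3 \<and>
     (\<forall>p\<in>M. \<exists>(W :: (real^2) set) f.
        open W \<and> smooth_on f W \<and> (\<forall>w\<in>W. inj (frechet_derivative f (at w))) \<and>
        p \<in> f ` W \<and> openin (top_of_set M) (f ` W) \<and>
        (\<exists>g. homeomorphism W (f ` W) f g))"

definition unit_normal_field :: "(real^5) set \<Rightarrow> (real^5 \<Rightarrow> real^5) \<Rightarrow> bool" where
  "unit_normal_field M n \<longleftrightarrow>
     smooth_map_on_set n M \<and>
     (\<forall>p\<in>M. n p \<in> tangent_space S3 p \<and> lor (n p) (n p) = 1 \<and>
             (\<forall>v \<in> tangent_space M p. lor (n p) v = 0))"

text \<open>
  \<open>k\<close> is an eigenvalue at \<open>p\<close> of the shape operator $-dn$.  The sign is the one for which the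
  normal curvature in the corresponding eigendirection is \<open>k\<close>.
\<close>
definition principal_curvature :: "(real^5) set \<Rightarrow> (real^5 \<Rightarrow> real^5) \<Rightarrow> real^5 \<Rightarrow> real \<Rightarrow> bool" where
  "principal_curvature M n p k \<longleftrightarrow>
     (\<exists>\<gamma> v. \<gamma> 0 = p \<and> (\<forall>\<^sub>F s in nhds (0::real). \<gamma> s \<in> M) \<and> v \<noteq> 0 \<and>
            (\<gamma> has_vector_derivative v) (at 0) \<and>
            ((\<lambda>s. n (\<gamma> s)) has_vector_derivative (- k) *\<^sub>R v) (at 0))"


subsection \<open>Curves on a surface and the Darboux frame\<close>

definition unit_speed_curve :: "(real^5) set \<Rightarrow> (real \<Rightarrow> real^5) \<Rightarrow> real set \<Rightarrow> bool" where
  "unit_speed_curve M c I \<longleftrightarrow>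
     open I \<and> is_interval I \<and> smooth_on c I \<and> c ` I \<subseteq> M \<and>
     (\<forall>t\<in>I. lor (vector_derivative c (at t)) (vector_derivative c (at t)) = 1)"

text \<open>
  Covariant derivative in the 3-sphere of a field \<open>X\<close> tangent to it along \<open>c\<close>: the projection of
  the derivative of \<open>X\<close> to the tangent space.  Since \<open>X\<close> and its derivative have zeroth coordinate
  \<open>0\<close>, this removes the component along the unit radial vector \<open>c t - axis 0 1\<close>.
\<close>
definition cov_deriv :: "(real \<Rightarrow> real^5) \<Rightarrow> (real \<Rightarrow> real^5) \<Rightarrow> real \<Rightarrow> real^5" where
  "cov_deriv c X t =
     vector_derivative X (at t) - lor (vector_derivative X (at t)) (c t) *\<^sub>R (c t - axis 0 1)"

definition unit_tangent :: "(real \<Rightarrow> real^5) \<Rightarrow> real \<Rightarrow> real^5" where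
  "unit_tangent c t = vector_derivative c (at t)"

text \<open>
  \<open>N1\<close> is the second vector of the Darboux frame.  The determinant is that of the frame
  (position, \<open>T\<close>, \<open>N1\<close>, \<open>n\<close>) in the Euclidean 4-space containing the 3-sphere; its sign says that
  (\<open>T\<close>, \<open>N1\<close>) is positive for the orientation of \<open>M\<close> determined by \<open>n\<close>.
\<close>
definition darboux_normal ::
    "(real^5) set \<Rightarrow> (real^5 \<Rightarrow> real^5) \<Rightarrow> (real \<Rightarrow> real^5) \<Rightarrow> real set \<Rightarrow> (real \<Rightarrow> real^5) \<Rightarrow> bool" where
  "darboux_normal M n c I N1 \<longleftrightarrow>
     (\<forall>t\<in>I. N1 t \<in> tangent_space M (c t) \<and> lor (N1 t) (N1 t) = 1 \<and>
             lor (N1 t) (unit_tangent c t) = 0 \<and>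
             det ((\<chi> i. if i = 0 then axis 0 1 else if i = 1 then c t
                        else if i = 2 then unit_tangent c t
                        else if i = 3 then N1 t else n (c t)) :: real^5^5) > 0)"

definition normal_curvature :: "(real^5 \<Rightarrow> real^5) \<Rightarrow> (real \<Rightarrow> real^5) \<Rightarrow> real \<Rightarrow> real" where
  "normal_curvature n c t = lor (cov_deriv c (unit_tangent c) t) (n (c t))"

definition geodesic_curvature :: "(real \<Rightarrow> real^5) \<Rightarrow> (real \<Rightarrow> real^5) \<Rightarrow> real \<Rightarrow> real" where
  "geodesic_curvature c N1 t = lor (cov_deriv c (unit_tangent c) t) (N1 t)"

definition geodesic_torsion ::
    "(real^5 \<Rightarrow> real^5) \<Rightarrow> (real \<Rightarrow> real^5) \<Rightarrow> (real \<Rightarrow> real^5) \<Rightarrow> real \<Rightarrow> real" where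
  "geodesic_torsion n c N1 t = - lor (cov_deriv c (\<lambda>s. n (c s)) t) (N1 t)"


subsection \<open>Darboux curves\<close>

definition contact_order_ge :: "nat \<Rightarrow> (real \<Rightarrow> real^5) \<Rightarrow> real \<Rightarrow> real^5 \<Rightarrow> bool" where
  "contact_order_ge r c t \<sigma> \<longleftrightarrow> (\<forall>j\<le>r. (deriv ^^ j) (\<lambda>s. lor \<sigma> (c s)) t = 0)"

definition osculating_sphere :: "(real \<Rightarrow> real^5) \<Rightarrow> real \<Rightarrow> real^5 \<Rightarrow> bool" where
  "osculating_sphere c t \<sigma> \<longleftrightarrow> \<sigma> \<in> Lambda4 \<and> contact_order_ge 3 c t \<sigma>"

definition sphere_tangent_to :: "real^5 \<Rightarrow> (real^5) set \<Rightarrow> real^5 \<Rightarrow> bool" where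
  "sphere_tangent_to \<sigma> M p \<longleftrightarrow>
     p \<in> sphere_of \<sigma> \<inter> M \<and> tangent_space (sphere_of \<sigma>) p = tangent_space M p"

text \<open>
  The osculating sphere is not unique at points where the osculating circle itself has contact of
  order 3 with the curve; there, one of the osculating spheres is required to be tangent to \<open>M\<close>.
\<close>
definition darboux_curve :: "(real^5) set \<Rightarrow> (real \<Rightarrow> real^5) \<Rightarrow> real set \<Rightarrow> bool" where
  "darboux_curve M c I \<longleftrightarrow>
     (\<forall>t\<in>I. \<exists>\<sigma>. osculating_sphere c t \<sigma> \<and> sphere_tangent_to \<sigma> M (c t))"


subsection \<open>The hypersurface V(M), the canonical section and geodesics\<close>

text \<open>
  A sphere may be tangent to \<open>M\<close> at several points, so the set V(M) can intersect itself.  It is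
  treated as an immersed hypersurface: the image under \<open>V_map n\<close> of the pairs (contact point,
  curvature).
\<close>
definition V_dom :: "(real^5) set \<Rightarrow> (real^5 \<Rightarrow> real^5) \<Rightarrow> ((real^5) \<times> real) set" where
  "V_dom M n =
     {(m, k). m \<in> M \<and>
        (\<exists>k1 k2. principal_curvature M n m k1 \<and> principal_curvature M n m k2 \<and> k1 \<le> k \<and> k \<le> k2)}"

definition V_map :: "(real^5 \<Rightarrow> real^5) \<Rightarrow> (real^5) \<times> real \<Rightarrow> real^5" where
  "V_map n = (\<lambda>(m, k). k *\<^sub>R m + n m)"

text \<open>Velocities of curves in V(M), along the sheet through the contact element \<open>p\<close>.\<close>
definition V_tangent :: "(real^5) set \<Rightarrow> (real^5 \<Rightarrow> real^5) \<Rightarrow> (real^5) \<times> real \<Rightarrow> (real^5) set" where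
  "V_tangent M n p =
     {w. \<exists>\<gamma>. \<gamma> 0 = p \<and> (\<forall>\<^sub>F s in nhds (0::real). \<gamma> s \<in> V_dom M n) \<and>
             \<gamma> differentiable (at 0) \<and>
             ((\<lambda>s. V_map n (\<gamma> s)) has_vector_derivative w) (at 0)}"

definition cansec_lift :: "(real^5 \<Rightarrow> real^5) \<Rightarrow> (real \<Rightarrow> real^5) \<Rightarrow> real \<Rightarrow> (real^5) \<times> real" where
  "cansec_lift n c t = (c t, normal_curvature n c t)"

definition cansec :: "(real^5 \<Rightarrow> real^5) \<Rightarrow> (real \<Rightarrow> real^5) \<Rightarrow> real \<Rightarrow> real^5" where
  "cansec n c t = V_map n (cansec_lift n c t)"

text \<open>
  The square of the velocity of \<open>cansec n c\<close> is the square of the geodesic torsion, so the canonical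
  section is space-like exactly where \<open>c\<close> is not tangent to a principal direction.  Arc length, hence
  the notion of geodesic, is only available there.
\<close>
definition spacelike_on :: "(real \<Rightarrow> real^5) \<Rightarrow> real set \<Rightarrow> bool" where
  "spacelike_on \<sigma> J \<longleftrightarrow>
     (\<forall>t\<in>J. \<sigma> differentiable (at t) \<and>
             lor (vector_derivative \<sigma> (at t)) (vector_derivative \<sigma> (at t)) > 0)"

text \<open>
  The curve in V(M) with lift \<open>\<gamma>\<close> is a geodesic: \<open>\<phi>\<close> is a change of parameter to arc length,
  \<open>\<sigma>'\<close> and \<open>\<sigma>''\<close> are the derivatives with respect to arc length, and \<open>\<sigma>'' + \<sigma>\<close> is the geodesic
  curvature vector.
\<close>
definition geodesic_in_V ::
    "(real^5) set \<Rightarrow> (real^5 \<Rightarrow> real^5) \<Rightarrow> (real \<Rightarrow> (real^5) \<times> real) \<Rightarrow> real set \<Rightarrow> bool" where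
  "geodesic_in_V M n \<gamma> J \<longleftrightarrow>
     (\<forall>t\<in>J. \<gamma> t \<in> V_dom M n) \<and>
     (\<exists>\<phi> K \<sigma> \<sigma>' \<sigma>''.
        open K \<and> is_interval K \<and> bij_betw \<phi> K J \<and>
        (\<forall>s\<in>K. \<phi> differentiable (at s) \<and> deriv \<phi> s > 0) \<and>
        \<sigma> = (\<lambda>s. V_map n (\<gamma> (\<phi> s))) \<and>
        (\<forall>s\<in>K. (\<sigma> has_vector_derivative \<sigma>' s) (at s) \<and>
                (\<sigma>' has_vector_derivative \<sigma>'' s) (at s) \<and>
                lor (\<sigma>' s) (\<sigma>' s) = 1 \<and>
                (\<forall>w \<in> V_tangent M n (\<gamma> (\<phi> s)). lor (\<sigma>'' s + \<sigma> s) w = 0)))"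

end

(* Along the curve, n' = - k_n T - tau_g N_1 and c'' = (e_0 - c) + k_g N_1 + k_n n, where e_0 is the
   zeroth basis vector.  A sphere tangent to M at c(t) is +-(k c + n), and contact of order 2 forces
   k = k_n.  Differentiating L(k_n c + n, c'') = 0 gives L(k_n c + n, c''') = k_n' + tau_g k_g, so
   contact of order 3 is the vanishing of this quantity.

   The canonical section has velocity k_n' c - tau_g N_1.  The component along T of its geodesic
   curvature vector is a positive multiple of k_n' + tau_g k_g.  All tangent vectors of V(M) are
   orthogonal to c, so if this component vanishes the curvature vector is a multiple of c and hence
   orthogonal to V(M).  Conversely, when tau_g is nonzero, k_n lies strictly between the principal
   curvatures; then V(M) has at k_n c + n a tangent vector with T-component - tau_g, obtained by moving
   the contact point in the direction N_1 at fixed curvature, and testing against it recovers the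
   equation.  Both the location of k_n and that T-component use the symmetry of the shape operator. *)
theory Submission
  imports Defs
begin

subsection \<open>The Lorentz form\<close>

text \<open>Three objects come with less regularity than the computation asks for. \<open>N1\<close>
  is prescribed point by point, so its differentiability has to be extracted from the orientation
  condition. \<open>n\<close> is smooth only through local extensions off M, so its derivatives are
  taken along curves in M. The parameter change in \<open>geodesic_in_V\<close> is only assumed once
  differentiable. For a given geodesic, \<open>\<sigma>''\<close> is therefore never computed; its
  components are read off by differentiating constant pairings. Conversely, the equation cancels
  \<tau> from the unit velocity, so that continuity of \<tau> is enough. V(M) has a boundary, where
  k is a principal curvature, and \<open>V_tangent\<close> admits only velocities of curves that
  stay inside. The test vector thus needs an actual path in \<open>V_dom\<close>; it exists because
  the characteristic determinant at k_n is minus the square of \<tau>, and a strict inequality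
  persists near the contact point.\<close>

lemma UNIV_5: "(UNIV :: 5 set) = {0, 1, 2, 3, 4}"
proof -
  have "x \<in> {0, 1, 2, 3, 4}" for x :: 5
  proof (induct x)
    case (of_int z)
    then have "z = 0 \<or> z = 1 \<or> z = 2 \<or> z = 3 \<or> z = 4" by fastforce
    then show ?case by auto
  qed
  then show ?thesis by blast
qed

lemma sum_5: "sum f (UNIV :: 5 set) = f 0 + f 1 + f 2 + f 3 + f 4"
  unfolding UNIV_5 by (simp add: ac_simps)

lemma lor_inner: "lor u v = u \<bullet> v - 2 * (u $ 0 * v $ 0)"
  unfolding lor_def inner_vec_def sum_5 by simp

lemma lor_commute: "lor u v = lor v u"
  by (simp add: lor_def mult.commute)

lemma bounded_bilinear_lor: "bounded_bilinear lor"
  unfolding bilinear_conv_bounded_bilinear [symmetric] bilinear_def lor_inner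
  by (intro conjI allI linearI) (simp_all add: inner_left_distrib inner_right_distrib algebra_simps)

interpretation lor: bounded_bilinear lor
  by (rule bounded_bilinear_lor)

text \<open>Vectors tangent to the 3-sphere have zeroth coordinate 0. On them the form is Euclidean,
  hence definite, and the library results on orthogonality apply.\<close>

lemma lor_eq_inner: "u $ 0 = 0 \<or> v $ 0 = 0 \<Longrightarrow> lor u v = u \<bullet> v"
  by (auto simp: lor_inner)

lemma lor_origin: "lor (axis 0 1) v = - v $ 0"
  by (simp add: lor_inner inner_axis')

subsection \<open>Smooth maps\<close>

lemma smooth_on_differentiable: "smooth_on f S \<Longrightarrow> x \<in> S \<Longrightarrow> f differentiable (at x)"
  using Ck_on.simps(2) unfolding smooth_on_def by blast

lemma smooth_on_has_derivative:
  "smooth_on f S \<Longrightarrow> x \<in> S \<Longrightarrow> (f has_derivative frechet_derivative f (at x)) (at x)"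
  using smooth_on_differentiable frechet_derivative_works by blast

lemma smooth_on_continuous_on: "smooth_on f S \<Longrightarrow> continuous_on S f"
  using Ck_on.simps(1) unfolding smooth_on_def by blast

lemma smooth_on_frechet_derivative:
  "smooth_on f S \<Longrightarrow> smooth_on (\<lambda>x. frechet_derivative f (at x) v) S"
  using Ck_on.simps(2) unfolding smooth_on_def by blast

text \<open>At points of an open set the derivative sees only nearby values, so agreement on
  \<open>S\<close> passes to all orders. This permits replacing
  \<open>frechet_derivative f (at t) 1\<close> by \<open>vector_derivative f (at t)\<close>.\<close>

lemma Ck_on_cong:
  assumes "open S" "\<And>x. x \<in> S \<Longrightarrow> f x = g x" "Ck_on k f S"
  shows "Ck_on k g S"
  using assms(2,3)
proof (induction k arbitrary: f g)
  case 0
  then show ?case by (simp cong: continuous_on_cong)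
next
  case (Suc k)
  have d: "(g has_derivative frechet_derivative f (at x)) (at x)" if "x \<in> S" for x
    using has_derivative_transform_within_open [OF _ assms(1) that Suc.prems(1)]
      Suc.prems(2) that by (simp add: frechet_derivative_works)
  then have "frechet_derivative f (at x) = frechet_derivative g (at x)" if "x \<in> S" for x
    using frechet_derivative_at that by blast
  then have "Ck_on k (\<lambda>x. frechet_derivative g (at x) v) S" for v
    using Suc.IH [of "\<lambda>x. frechet_derivative f (at x) v"] Suc.prems(2) by simp
  then show ?case
    using d by (auto simp: differentiable_def)
qed

lemma smooth_on_vector_derivative:
  fixes f :: "real \<Rightarrow> 'a::real_normed_vector"
  assumes "open S" "smooth_on f S"
  shows "smooth_on (\<lambda>t. vector_derivative f (at t)) S"
proof -
  have "frechet_derivative f (at t) 1 = vector_derivative f (at t)" if "t \<in> S" for t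
  proof -
    have "(f has_vector_derivative frechet_derivative f (at t) 1) (at t)"
      using smooth_on_differentiable [OF assms(2) that] smooth_on_has_derivative [OF assms(2) that]
      by (simp add: has_vector_derivative_def linear_cmul [OF linear_frechet_derivative, symmetric])
    then show ?thesis
      using vector_derivative_at by metis
  qed
  then show ?thesis
    using Ck_on_cong [OF assms(1), of "\<lambda>t. frechet_derivative f (at t) 1" "\<lambda>t. vector_derivative f (at t)"]
      smooth_on_frechet_derivative [OF assms(2), of 1]
    unfolding smooth_on_def by blast
qed

lemma smooth_on_has_vector_derivative:
  fixes f :: "real \<Rightarrow> 'a::real_normed_vector"
  assumes "smooth_on f S" "t \<in> S"
  shows "(f has_vector_derivative vector_derivative f (at t)) (at t)"
  using smooth_on_differentiable [OF assms] vector_derivative_works by blast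

text \<open>\<open>smooth_on\<close> gives continuity in the base point for each fixed direction.
  Expanding the direction in \<open>Basis\<close> upgrades this to joint continuity.\<close>

lemma continuous_on_frechet_derivative:
  fixes g :: "'a::euclidean_space \<Rightarrow> 'b::real_normed_vector"
  assumes g: "smooth_on g U" and u: "continuous_on S u" "u ` S \<subseteq> U" and v: "continuous_on S v"
  shows "continuous_on S (\<lambda>s. frechet_derivative g (at (u s)) (v s))"
proof -
  have "frechet_derivative g (at (u s)) (v s)
      = (\<Sum>b\<in>Basis. (v s \<bullet> b) *\<^sub>R frechet_derivative g (at (u s)) b)" if "s \<in> S" for s
  proof -
    have "linear (frechet_derivative g (at (u s)))"
      using u that g by (intro linear_frechet_derivative smooth_on_differentiable) auto
    then have "frechet_derivative g (at (u s)) (\<Sum>b\<in>Basis. (v s \<bullet> b) *\<^sub>R b)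
      = (\<Sum>b\<in>Basis. (v s \<bullet> b) *\<^sub>R frechet_derivative g (at (u s)) b)"
      by (simp add: linear_sum linear_cmul)
    then show ?thesis
      by (simp add: euclidean_representation)
  qed
  moreover have "continuous_on S (\<lambda>s. frechet_derivative g (at (u s)) b)" for b
    using continuous_on_compose2 [OF smooth_on_continuous_on [OF smooth_on_frechet_derivative [OF g]] u]
    by blast
  then have "continuous_on S (\<lambda>s. \<Sum>b\<in>Basis. (v s \<bullet> b) *\<^sub>R frechet_derivative g (at (u s)) b)"
    by (intro continuous_intros v)
  ultimately show ?thesis
    by (simp cong: continuous_on_cong)
qed

lemma smooth_on_chain:
  assumes "(\<gamma> has_vector_derivative v) (at s)" "smooth_on g U" "\<gamma> s \<in> U"
  shows "((\<lambda>s. g (\<gamma> s)) has_vector_derivative frechet_derivative g (at (\<gamma> s)) v) (at s)"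
  using has_derivative_compose [OF assms(1) [unfolded has_vector_derivative_def]
      smooth_on_has_derivative [OF assms(2,3)]]
    linear_cmul [OF linear_frechet_derivative [OF smooth_on_differentiable [OF assms(2,3)]]]
  by (simp add: has_vector_derivative_def)

lemma smooth_on_line:
  assumes "smooth_on g W" "p + s *\<^sub>R u \<in> W"
  shows "((\<lambda>s. g (p + s *\<^sub>R u)) has_vector_derivative frechet_derivative g (at (p + s *\<^sub>R u)) u) (at s)"
  by (rule smooth_on_chain [where \<gamma>="\<lambda>s. p + s *\<^sub>R u", OF _ assms]) (auto intro!: derivative_eq_intros)

section \<open>Symmetry of second derivatives\<close>

lemma second_difference_mvt:
  fixes F P G :: "real \<Rightarrow> real \<Rightarrow> real"
  assumes "0 < h"
    and P: "\<And>s t. \<lbrakk>0 \<le> s; s \<le> h; 0 \<le> t; t \<le> h\<rbrakk> \<Longrightarrow> ((\<lambda>s. F s t) has_real_derivative P s t) (at s)"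
    and G: "\<And>s t. \<lbrakk>0 \<le> s; s \<le> h; 0 \<le> t; t \<le> h\<rbrakk> \<Longrightarrow> (P s has_real_derivative G s t) (at t)"
  obtains x y where "0 < x" "x < h" "0 < y" "y < h"
    and "F h h - F h 0 - F 0 h + F 0 0 = h * (h * G x y)"
proof -
  \<comment> \<open>The mean value theorem is applied to the increment in the second variable as a
    function of the first, and then to \<open>P x\<close>.\<close>
  have "\<exists>x>0. x < h \<and> (F h h - F h 0) - (F 0 h - F 0 0) = (h - 0) * (P x h - P x 0)"
    using \<open>0 < h\<close> by (intro MVT2 DERIV_diff P) auto
  then obtain x where x: "0 < x" "x < h" "F h h - F h 0 - F 0 h + F 0 0 = h * (P x h - P x 0)"
    by auto
  have "\<exists>y>0. y < h \<and> P x h - P x 0 = (h - 0) * G x y"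
    using \<open>0 < h\<close> x by (intro MVT2 G) auto
  with x that show ?thesis
    by auto
qed

text \<open>One second difference over a small parallelogram has two mean value forms, one for each
  order of differentiation; continuity of both second derivatives at \<open>w\<close> makes them
  agree. It yields the symmetry of the shape operator.\<close>

lemma frechet_derivative_commute:
  fixes f :: "'a::real_normed_vector \<Rightarrow> 'b::euclidean_space"
  assumes "open W" "smooth_on f W" "w \<in> W"
  shows "frechet_derivative (\<lambda>x. frechet_derivative f (at x) a) (at w) b
       = frechet_derivative (\<lambda>x. frechet_derivative f (at x) b) (at w) a"
proof -
  define D where "D u x = frechet_derivative f (at x) u" for u x
  define D2 where "D2 u v x = frechet_derivative (D u) (at x) v" for u v x
  have sD: "smooth_on (D u) W" for u
    unfolding D_def by (rule smooth_on_frechet_derivative [OF assms(2)])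
  have cD2: "continuous_on W (D2 u v)" for u v
    unfolding D2_def by (intro smooth_on_continuous_on smooth_on_frechet_derivative sD)
  \<comment> \<open>The mean value theorem concerns real functions, hence the pairing with an
    arbitrary \<open>e\<close>. A gap between the two sides is twice \<open>d\<close>, and two
    errors smaller than \<open>d\<close> cannot bridge it.\<close>
  have "D2 a b w \<bullet> e = D2 b a w \<bullet> e" for e
  proof (rule ccontr)
    assume ne: "D2 a b w \<bullet> e \<noteq> D2 b a w \<bullet> e"
    define d where "d = \<bar>D2 a b w \<bullet> e - D2 b a w \<bullet> e\<bar> / 2"
    have "d > 0" using ne by (simp add: d_def)
    have cont: "\<forall>\<^sub>F x in nhds w. \<bar>D2 u v x \<bullet> e - D2 u v w \<bullet> e\<bar> < d" for u v
    proof -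
      have "isCont (\<lambda>x. D2 u v x \<bullet> e) w"
        using cD2 [of u v] assms(1,3) by (intro continuous_intros) (simp add: continuous_on_eq_continuous_at)
      then have "((\<lambda>x. D2 u v x \<bullet> e) \<longlongrightarrow> D2 u v w \<bullet> e) (nhds w)"
        using tendsto_at_iff_tendsto_nhds [of "\<lambda>x. D2 u v x \<bullet> e" w] by (simp add: isCont_def)
      then show ?thesis
        using \<open>d > 0\<close> by (simp add: tendsto_iff dist_real_def)
    qed
    have "\<forall>\<^sub>F x in nhds w. x \<in> W \<and> \<bar>D2 a b x \<bullet> e - D2 a b w \<bullet> e\<bar> < d \<and> \<bar>D2 b a x \<bullet> e - D2 b a w \<bullet> e\<bar> < d"
      using cont eventually_nhds_in_open [OF assms(1,3)] by (intro eventually_conj) auto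
    then obtain r where r: "r > 0"
      "\<And>x. dist x w < r \<Longrightarrow> x \<in> W \<and> \<bar>D2 a b x \<bullet> e - D2 a b w \<bullet> e\<bar> < d \<and> \<bar>D2 b a x \<bullet> e - D2 b a w \<bullet> e\<bar> < d"
      unfolding eventually_nhds_metric by blast
    \<comment> \<open>The summand 1 keeps \<open>q\<close> positive when \<open>a\<close> and
      \<open>b\<close> vanish; \<open>h\<close> is chosen so that the parallelogram with sides
      \<open>h\<close> times \<open>a\<close> and \<open>b\<close> stays in the ball of radius
      \<open>r\<close>.\<close>
    define q where "q = norm a + norm b + 1"
    have "q > 0"
      by (simp add: q_def add_nonneg_pos)
    define h where "h = r / (2 * q)"
    have "h > 0"
      using r(1) \<open>q > 0\<close> by (simp add: h_def)
    have near: "dist (w + s *\<^sub>R a + t *\<^sub>R b) w < r" if "0 \<le> s" "s \<le> h" "0 \<le> t" "t \<le> h" for s t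
    proof -
      have "norm (s *\<^sub>R a + t *\<^sub>R b) \<le> s * norm a + t * norm b"
        using norm_triangle_ineq [of "s *\<^sub>R a" "t *\<^sub>R b"] that by simp
      also have "\<dots> \<le> h * norm a + h * norm b"
        using that by (intro add_mono mult_right_mono) auto
      also have "\<dots> \<le> h * (norm a + norm b + 1)"
        using \<open>h > 0\<close> by (simp add: algebra_simps)
      also have "\<dots> = r / 2"
        using \<open>q > 0\<close> by (simp add: h_def q_def [symmetric])
      also have "\<dots> < r"
        using r(1) by simp
      finally show ?thesis
        by (simp add: dist_norm add.assoc)
    qed
    define F where "F s t = f (w + s *\<^sub>R a + t *\<^sub>R b) \<bullet> e" for s t
    have swap: "w + s *\<^sub>R a + t *\<^sub>R b = w + t *\<^sub>R b + s *\<^sub>R a" for s t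
      by simp
    have inner_deriv: "((\<lambda>s. g s \<bullet> e) has_real_derivative g' \<bullet> e) (at s)"
      if "(g has_vector_derivative g') (at s)" for g :: "real \<Rightarrow> 'b" and g' s
      using bounded_linear.has_vector_derivative [OF bounded_linear_inner_left that]
      by (simp add: has_real_derivative_iff_has_vector_derivative)
    have line_a: "((\<lambda>s. g (w + s *\<^sub>R a + t *\<^sub>R b) \<bullet> e) has_real_derivative
        frechet_derivative g (at (w + s *\<^sub>R a + t *\<^sub>R b)) a \<bullet> e) (at s)"
      and line_b: "((\<lambda>t. g (w + s *\<^sub>R a + t *\<^sub>R b) \<bullet> e) has_real_derivative
        frechet_derivative g (at (w + s *\<^sub>R a + t *\<^sub>R b)) b \<bullet> e) (at t)"
      if "smooth_on g W" "0 \<le> s" "s \<le> h" "0 \<le> t" "t \<le> h" for g :: "'a \<Rightarrow> 'b" and s t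
      using smooth_on_line [OF that(1), of "w + t *\<^sub>R b" s a] smooth_on_line [OF that(1), of "w + s *\<^sub>R a" t b]
        r(2) [OF near [OF that(2-5)]]
      by (auto intro!: inner_deriv simp: swap)
    obtain x y where xy: "0 < x" "x < h" "0 < y" "y < h"
      and e1: "F h h - F h 0 - F 0 h + F 0 0 = h * (h * (D2 a b (w + x *\<^sub>R a + y *\<^sub>R b) \<bullet> e))"
      by (rule second_difference_mvt [where F=F and P="\<lambda>s t. D a (w + s *\<^sub>R a + t *\<^sub>R b) \<bullet> e"
            and G="\<lambda>s t. D2 a b (w + s *\<^sub>R a + t *\<^sub>R b) \<bullet> e", OF \<open>h > 0\<close>])
         (use line_a [OF assms(2)] line_b [OF sD] in \<open>auto simp: F_def D2_def D_def\<close>)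
    \<comment> \<open>The same second difference, with the roles of the two variables
      exchanged.\<close>
    obtain x' y' where xy': "0 < y'" "y' < h" "0 < x'" "x' < h"
      and e2: "F h h - F 0 h - F h 0 + F 0 0 = h * (h * (D2 b a (w + x' *\<^sub>R a + y' *\<^sub>R b) \<bullet> e))"
      by (rule second_difference_mvt [where F="\<lambda>t s. F s t" and P="\<lambda>t s. D b (w + s *\<^sub>R a + t *\<^sub>R b) \<bullet> e"
            and G="\<lambda>t s. D2 b a (w + s *\<^sub>R a + t *\<^sub>R b) \<bullet> e", OF \<open>h > 0\<close>])
         (use line_b [OF assms(2)] line_a [OF sD] in \<open>auto simp: F_def D2_def D_def\<close>)
    have "D2 a b (w + x *\<^sub>R a + y *\<^sub>R b) \<bullet> e = D2 b a (w + x' *\<^sub>R a + y' *\<^sub>R b) \<bullet> e"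
    proof -
      have "h * (h * (D2 a b (w + x *\<^sub>R a + y *\<^sub>R b) \<bullet> e))
          = h * (h * (D2 b a (w + x' *\<^sub>R a + y' *\<^sub>R b) \<bullet> e))"
        using e1 e2 by linarith
      then show ?thesis
        using \<open>h > 0\<close> by simp
    qed
    moreover have "\<bar>D2 a b (w + x *\<^sub>R a + y *\<^sub>R b) \<bullet> e - D2 a b w \<bullet> e\<bar> < d"
      using r(2) near xy by simp
    moreover have "\<bar>D2 b a (w + x' *\<^sub>R a + y' *\<^sub>R b) \<bullet> e - D2 b a w \<bullet> e\<bar> < d"
      using r(2) near xy' by simp
    ultimately show False
      unfolding d_def by argo
  qed
  then have "D2 a b w = D2 b a w"
    using inner_eq_zero_iff inner_diff_left by (metis eq_iff_diff_eq_0)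
  then show ?thesis
    by (simp add: D2_def D_def [abs_def])
qed

lemma isCont_det:
  fixes A :: "'a::t2_space \<Rightarrow> real^'n^'n"
  assumes "\<And>i j. isCont (\<lambda>s. A s $ i $ j) t"
  shows "isCont (\<lambda>s. det (A s)) t"
  unfolding det_def by (intro continuous_intros assms)

subsection \<open>Parametrization by arc length\<close>

text \<open>\<open>v\<close> is the speed and \<phi> the inverse function of an antiderivative of
  it. Continuity of \<open>v\<close> suffices, at the price that \<phi> is only known to be once
  differentiable.\<close>

lemma arc_length_parameter:
  fixes v :: "real \<Rightarrow> real"
  assumes J: "open J" "is_interval J" and v: "continuous_on J v" "\<And>t. t \<in> J \<Longrightarrow> 0 < v t"
  obtains \<phi> K where "open K" "is_interval K" "bij_betw \<phi> K J"
    and "\<And>s. s \<in> K \<Longrightarrow> (\<phi> has_real_derivative inverse (v (\<phi> s))) (at s)"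
proof (cases "J = {}")
  case True
  then show ?thesis
    using that [of "{}" id] by (auto simp: bij_betw_def is_interval_empty)
next
  case False
  \<comment> \<open>\<open>J\<close> may be unbounded, so its endpoints are taken in the extended
    reals; openness of \<open>J\<close> is what excludes them.\<close>
  define a b where "a = Inf (ereal ` J)" and "b = Sup (ereal ` J)"
  have J_eq: "t \<in> J \<longleftrightarrow> a < ereal t \<and> ereal t < b" for t
  proof
    assume "t \<in> J"
    then obtain e where e: "e > 0" "\<And>s. \<bar>s - t\<bar> < e \<Longrightarrow> s \<in> J"
      using J(1) unfolding open_dist dist_real_def by blast
    have "t - e/2 \<in> J" "t + e/2 \<in> J"
      using e by auto
    then have "a \<le> ereal (t - e/2)" "ereal (t + e/2) \<le> b"
      unfolding a_def b_def by (auto intro: Inf_lower Sup_upper)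
    moreover have "ereal (t - e/2) < ereal t" "ereal t < ereal (t + e/2)"
      using e(1) by auto
    ultimately show "a < ereal t \<and> ereal t < b"
      using le_less_trans less_le_trans by blast
  next
    assume "a < ereal t \<and> ereal t < b"
    then obtain x y where "x \<in> J" "y \<in> J" "x < t" "t < y"
      unfolding a_def b_def by (auto simp: Inf_less_iff less_Sup_iff)
    then show "t \<in> J"
      using J(2) unfolding is_interval_1 by (meson less_imp_le)
  qed
  have "a < b"
    using False J_eq less_trans by blast
  then obtain F where "\<forall>t. a < ereal t \<longrightarrow> ereal t < b \<longrightarrow> (F has_vector_derivative v t) (at t)"
    using einterval_antiderivative [of a b v] v(1) J(1) J_eq
    by (auto simp: continuous_on_eq_continuous_at)
  then have F: "(F has_real_derivative v t) (at t)" if "t \<in> J" for t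
    using J_eq that by (auto simp: has_real_derivative_iff_has_vector_derivative)
  have less: "F x < F y" if "x \<in> J" "y \<in> J" "x < y" for x y
  proof (rule DERIV_pos_imp_increasing [OF \<open>x < y\<close>])
    fix t assume "x \<le> t" "t \<le> y"
    then have "t \<in> J"
      using J(2) that unfolding is_interval_1 by blast
    then show "\<exists>d. (F has_real_derivative d) (at t) \<and> 0 < d"
      using F v(2) by blast
  qed
  then have inj: "inj_on F J"
    by (metis inj_onI less_irrefl linorder_neqE_linordered_idom)
  have contF: "continuous_on J F"
    using F by (intro continuous_at_imp_continuous_on ballI) (blast intro: DERIV_isCont)
  define \<phi> where "\<phi> = inv_into J F"
  have \<phi>: "\<phi> (F t) = t" if "t \<in> J" for t
    using inj that by (simp add: \<phi>_def)
  show ?thesis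
  proof (rule that [of "F ` J" \<phi>])
    show "open (F ` J)"
      using injective_eq_1d_open_map_UNIV [OF contF J(2)] inj J(1) by blast
    show "is_interval (F ` J)"
      using connected_continuous_image [OF contF] J(2) by (simp add: is_interval_connected_1)
    show "bij_betw \<phi> (F ` J) J"
      unfolding \<phi>_def by (intro bij_betw_inv_into inj_on_imp_bij_betw inj)
    fix s assume "s \<in> F ` J"
    then obtain t where t: "t \<in> J" "s = F t" by blast
    have "(\<phi> has_derivative (\<lambda>h. inverse (v t) * h)) (at (F t))"
    proof (rule has_derivative_inverse_strong [OF J(1) t(1) contF \<phi>])
      show "(F has_derivative (\<lambda>h. v t * h)) (at t)"
        using F [OF t(1)] by (simp add: has_field_derivative_def)
      show "(\<lambda>h. v t * h) \<circ> (\<lambda>h. inverse (v t) * h) = id"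
        using v(2) [OF t(1)] by auto
    qed
    then show "(\<phi> has_real_derivative inverse (v (\<phi> s))) (at s)"
      using t \<phi> by (simp add: has_field_derivative_def)
  qed
qed

subsection \<open>Tangent planes\<close>

text \<open>Combined with the product rule for \<open>lor\<close>, this turns every pairing that is
  constant near a point into a linear relation between derivatives. The frame equations below are
  obtained in this way.\<close>

lemma has_vector_derivative_eventually_const:
  assumes "(f has_vector_derivative d) (at x)" "\<forall>\<^sub>F s in nhds x. f s = c"
  shows "d = 0"
proof -
  have "((\<lambda>_. c) has_vector_derivative d) (at x)"
    using assms has_vector_derivative_cong_ev [of UNIV f "\<lambda>_. c" x d] eventually_nhds_x_imp_x
    by auto
  then show ?thesis
    using vector_derivative_unique_at has_vector_derivative_const by blast
qed

lemma nth_has_vector_derivative: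
  "(f has_vector_derivative d) F \<Longrightarrow> ((\<lambda>s. f s $ i) has_vector_derivative d $ i) F"
  by (rule bounded_linear.has_vector_derivative [OF bounded_linear_vec_nth])

text \<open>The tangent plane at \<open>p\<close> of every sphere through \<open>p\<close> with normal \<open>\<nu>\<close> there.\<close>
definition tangent_plane :: "real^5 \<Rightarrow> real^5 \<Rightarrow> (real^5) set" where
  "tangent_plane p \<nu> = {v. v $ 0 = 0 \<and> lor v p = 0 \<and> lor v \<nu> = 0}"

lemma tangent_space_mono: "S \<subseteq> T \<Longrightarrow> tangent_space S p \<subseteq> tangent_space T p"
  unfolding tangent_space_def by (blast intro: eventually_mono)

lemma tangent_space_S3:
  assumes "v \<in> tangent_space S3 p"
  shows "v $ 0 = 0" "lor v p = 0"
proof -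
  obtain \<gamma> where \<gamma>: "\<gamma> 0 = p" "\<forall>\<^sub>F s in nhds 0. \<gamma> s \<in> S3" "(\<gamma> has_vector_derivative v) (at 0)"
    using assms unfolding tangent_space_def by blast
  show "v $ 0 = 0"
    by (rule has_vector_derivative_eventually_const [OF nth_has_vector_derivative [OF \<gamma>(3)]])
       (use \<gamma>(2) in \<open>auto simp: S3_def elim: eventually_mono\<close>)
  have "lor (\<gamma> 0) v + lor v (\<gamma> 0) = 0"
    by (rule has_vector_derivative_eventually_const [OF lor.has_vector_derivative [OF \<gamma>(3) \<gamma>(3)]])
       (use \<gamma>(2) in \<open>auto simp: S3_def elim: eventually_mono\<close>)
  then show "lor v p = 0"
    using \<gamma>(1) by (simp add: lor_commute)
qed

lemma tangent_space_sphere_of: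
  assumes "v \<in> tangent_space (sphere_of \<sigma>) p"
  shows "lor \<sigma> v = 0"
proof -
  obtain \<gamma> where \<gamma>: "\<forall>\<^sub>F s in nhds 0. \<gamma> s \<in> sphere_of \<sigma>" "(\<gamma> has_vector_derivative v) (at 0)"
    using assms unfolding tangent_space_def by blast
  show ?thesis
    by (rule has_vector_derivative_eventually_const
          [OF bounded_linear.has_vector_derivative [OF lor.bounded_linear_right \<gamma>(2)]])
       (use \<gamma>(1) in \<open>auto simp: sphere_of_def elim: eventually_mono\<close>)
qed

text \<open>The inclusion from right to left needs a curve in the sphere with velocity
  \<open>v\<close>. It is a parabola in the light cone, orthogonal to the sphere vector. Its
  quadratic direction \<open>q\<close> starts from \<open>2 *\<^sub>R e - p\<close>, the antipode of
  \<open>p\<close>, scaled by 1/4; the terms in k are those of a null rotation fixing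
  \<open>p\<close>, which keeps it light-like and makes it orthogonal to
  \<open>\<sigma>\<close>.\<close>

lemma tangent_plane_sphere_of:
  assumes p: "p \<in> S3" and \<nu>: "\<nu> $ 0 = 0" "lor \<nu> p = 0" "lor \<nu> \<nu> = 1"
  shows "tangent_space (sphere_of (k *\<^sub>R p + \<nu>)) p = tangent_plane p \<nu>"
proof (intro equalityI subsetI)
  fix v assume v: "v \<in> tangent_space (sphere_of (k *\<^sub>R p + \<nu>)) p"
  have "sphere_of (k *\<^sub>R p + \<nu>) \<subseteq> S3"
    by (auto simp: sphere_of_def)
  then have "v \<in> tangent_space S3 p"
    using v tangent_space_mono by blast
  from tangent_space_S3 [OF this] tangent_space_sphere_of [OF v]
  show "v \<in> tangent_plane p \<nu>"
    by (simp add: tangent_plane_def lor.add_left lor.scaleR_left lor_commute [of p v] lor_commute [of \<nu> v])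
next
  fix v assume "v \<in> tangent_plane p \<nu>"
  then have v: "v $ 0 = 0" "lor v p = 0" "lor v \<nu> = 0"
    by (auto simp: tangent_plane_def)
  have p': "lor p p = 0" "p $ 0 = 1"
    using p by (auto simp: S3_def)
  define e where "e = (axis 0 1 :: real^5)"
  have e: "lor e x = - x $ 0" "lor x e = - x $ 0" "e $ 0 = 1" for x
    using lor_origin [of x] by (simp_all add: e_def lor_commute)
  define \<sigma> where "\<sigma> = k *\<^sub>R p + \<nu>"
  text \<open>A light-like vector orthogonal to \<open>\<sigma>\<close> and \<open>v\<close>, with \<open>lor p q = - 1 / 2\<close>, so that the
    parabola \<open>X\<close> below lies on the light cone.\<close>
  define q where "q = (1/4) *\<^sub>R (2 *\<^sub>R e - p) + (k/2) *\<^sub>R \<nu> + (k\<^sup>2/4) *\<^sub>R p"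
  note bil = lor.add_left lor.add_right lor.diff_left lor.diff_right lor.scaleR_left lor.scaleR_right
  have \<nu>': "lor p \<nu> = 0" "lor p v = 0" "lor \<nu> v = 0"
    using \<nu> v by (auto simp: lor_commute)
  have q: "lor p q = - 1/2" "lor q p = - 1/2" "lor q q = 0" "lor \<sigma> q = 0" "lor v q = 0" "lor q v = 0"
    using p' \<nu> v \<nu>' by (simp_all add: q_def \<sigma>_def bil e power2_eq_square algebra_simps)
  define X where "X s = p + s *\<^sub>R v + (s\<^sup>2 * lor v v) *\<^sub>R q" for s
  have X0: "X 0 = p"
    by (simp add: X_def)
  have XX: "lor (X s) (X s) = 0" "lor \<sigma> (X s) = 0" for s
    using p' \<nu> v \<nu>' q by (simp_all add: X_def bil power2_eq_square algebra_simps, simp add: \<sigma>_def bil)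
  have dX: "(X has_vector_derivative v) (at 0)"
    unfolding X_def [abs_def] by (auto intro!: derivative_eq_intros)
  have dX0: "((\<lambda>s. X s $ 0) has_real_derivative 0) (at 0)"
    using nth_has_vector_derivative [OF dX, of 0] v
    by (simp add: has_real_derivative_iff_has_vector_derivative)
  have ev: "\<forall>\<^sub>F s in nhds 0. X s $ 0 \<noteq> 0"
  proof -
    have "((\<lambda>s. X s $ 0) \<longlongrightarrow> X 0 $ 0) (nhds 0)"
      using DERIV_isCont [OF dX0] tendsto_at_iff_tendsto_nhds [of "\<lambda>s. X s $ 0" 0]
      by (simp add: isCont_def)
    then show ?thesis
      using p' by (intro tendsto_imp_eventually_ne) (auto simp: X0)
  qed
  \<comment> \<open>Dividing by the zeroth coordinate brings the parabola from the light cone to the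
    3-sphere. That coordinate is 1 and stationary at 0, so the velocity remains
    \<open>v\<close>.\<close>
  define \<gamma> where "\<gamma> s = inverse (X s $ 0) *\<^sub>R X s" for s
  have "((\<lambda>s. inverse (X s $ 0)) has_real_derivative 0) (at 0)"
    using DERIV_inverse_fun [OF dX0] p' by (simp add: X0)
  from has_vector_derivative_scaleR [OF this dX] have "(\<gamma> has_vector_derivative v) (at 0)"
    using p' by (simp add: \<gamma>_def [abs_def] X0)
  moreover have "\<forall>\<^sub>F s in nhds 0. \<gamma> s \<in> sphere_of \<sigma>"
    using ev by (rule eventually_mono) (simp add: \<gamma>_def sphere_of_def S3_def bil XX)
  moreover have "\<gamma> 0 = p"
    using p' by (simp add: \<gamma>_def X0)
  ultimately show "v \<in> tangent_space (sphere_of (k *\<^sub>R p + \<nu>)) p"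
    unfolding tangent_space_def \<sigma>_def by blast
qed

lemma card_orthonormal:
  assumes "set bs = B" "distinct bs" "\<And>x y. x \<in> B \<Longrightarrow> y \<in> B \<Longrightarrow> x \<bullet> y = (if x = y then 1 else 0)"
  shows "independent B" "card B = length bs"
proof -
  have "0 \<notin> B"
    using assms(3) [of 0 0] by auto
  then show "independent B"
    using assms(3) by (intro pairwise_orthogonal_independent) (auto simp: pairwise_def orthogonal_def)
  show "card B = length bs"
    using assms distinct_card by blast
qed

lemma tangent_plane_subspace: "subspace (tangent_plane p \<nu>)"
  by (auto simp: tangent_plane_def subspace_def lor.zero_left lor.add_left lor.scaleR_left)

text \<open>The plane is the Euclidean orthogonal complement of the three orthonormal vectors
  \<open>e\<close>, \<open>p - e\<close> and \<nu> in 5-space: for vectors with zeroth coordinate 0,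
  pairing with \<open>p\<close> and with \<open>p - e\<close> is the same.\<close>

lemma dim_tangent_plane:
  assumes p: "p \<in> S3" and \<nu>: "\<nu> $ 0 = 0" "lor \<nu> p = 0" "lor \<nu> \<nu> = 1"
  shows "dim (tangent_plane p \<nu>) = 2"
proof -
  define e where "e = (axis 0 1 :: real^5)"
  define r where "r = p - e"
  have e: "e \<bullet> x = x $ 0" "x \<bullet> e = x $ 0" "e $ 0 = 1" for x
    by (simp_all add: e_def inner_axis inner_axis')
  have p': "lor p p = 0" "p $ 0 = 1"
    using p by (auto simp: S3_def)
  have r: "r $ 0 = 0" "r \<bullet> r = 1" "\<nu> \<bullet> r = 0" "r \<bullet> \<nu> = 0" "\<nu> \<bullet> \<nu> = 1"
    using p' \<nu> by (auto simp: r_def e inner_diff lor_inner inner_commute)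
  let ?B = "{e, r, \<nu>}"
  have ne: "e \<noteq> r" "e \<noteq> \<nu>" "r \<noteq> \<nu>"
    using r e(3) \<nu>(1) by auto
  have "x \<bullet> y = (if x = y then 1 else 0)" if "x \<in> ?B" "y \<in> ?B" for x y
    using that ne ne [symmetric] r e \<nu>(1) by auto
  then have B: "independent ?B" "card ?B = 3"
    using card_orthonormal [of "[e, r, \<nu>]" ?B] ne by auto
  have "{y \<in> UNIV. \<forall>x \<in> span ?B. orthogonal x y} = tangent_plane p \<nu>"
  proof -
    have "(\<forall>x \<in> span ?B. orthogonal x y) \<longleftrightarrow> (\<forall>x \<in> ?B. orthogonal x y)" for y
      by (meson orthogonal_commute orthogonal_to_span span_base)
    then show ?thesis
      using \<nu>(1) by (auto simp: tangent_plane_def orthogonal_def e r_def inner_diff lor_inner inner_commute)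
  qed
  moreover have "dim {y \<in> UNIV. \<forall>x \<in> span ?B. orthogonal x y} + dim (span ?B) = dim (UNIV :: (real^5) set)"
    by (rule dim_subspace_orthogonal_to_vectors) auto
  ultimately show ?thesis
    using dim_span_eq_card_independent [OF B(1)] B(2) by simp
qed

lemma tangent_plane_eq_range:
  fixes A :: "real^2 \<Rightarrow> real^5"
  assumes p: "p \<in> S3" and \<nu>: "\<nu> $ 0 = 0" "lor \<nu> p = 0" "lor \<nu> \<nu> = 1"
    and A: "linear A" "inj A" "range A \<subseteq> tangent_plane p \<nu>"
  shows "range A = tangent_plane p \<nu>"
proof (rule subspace_dim_equal [OF _ tangent_plane_subspace A(3)])
  show "subspace (range A)"
    using A(1) by (simp add: linear_subspace_image)
  have "dim (range A) = 2"
    using dim_image_eq [of A UNIV] A by simp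
  then show "dim (tangent_plane p \<nu>) \<le> dim (range A)"
    using dim_tangent_plane [OF p \<nu>] by simp
qed

text \<open>The vectors \<open>e = axis 0 1\<close>, \<open>r = p - e\<close>, \<open>T\<close>,
  \<open>N\<close>, \<nu> form a Euclidean orthonormal basis. Since the coefficient of
  \<open>r\<close> is \<open>lor x p + x $ 0\<close> and \<open>e + r = p\<close>, regrouping gives
  the light-like vector \<open>p\<close> with coefficient \<open>x $ 0\<close>.\<close>

lemma frame_expansion:
  assumes p: "p \<in> S3" and zero: "T $ 0 = 0" "N $ 0 = 0" "\<nu> $ 0 = 0"
    and unit: "lor T T = 1" "lor N N = 1" "lor \<nu> \<nu> = 1"
    and orth: "lor T p = 0" "lor N p = 0" "lor \<nu> p = 0" "lor T N = 0" "lor T \<nu> = 0" "lor N \<nu> = 0"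
  shows "x = (x $ 0) *\<^sub>R p + lor x p *\<^sub>R (p - axis 0 1) + lor x T *\<^sub>R T + lor x N *\<^sub>R N + lor x \<nu> *\<^sub>R \<nu>"
proof -
  define e where "e = (axis 0 1 :: real^5)"
  define r where "r = p - e"
  have e: "e \<bullet> x = x $ 0" "x \<bullet> e = x $ 0" "e $ 0 = 1" for x
    by (simp_all add: e_def inner_axis inner_axis')
  have p': "lor p p = 0" "p $ 0 = 1"
    using p by (auto simp: S3_def)
  have r: "r $ 0 = 0" "r \<bullet> r = 1"
    using p' by (auto simp: r_def e inner_diff lor_inner inner_commute)
  have in1: "T \<bullet> T = 1" "N \<bullet> N = 1" "\<nu> \<bullet> \<nu> = 1" "T \<bullet> r = 0" "N \<bullet> r = 0" "\<nu> \<bullet> r = 0"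
     "T \<bullet> N = 0" "T \<bullet> \<nu> = 0" "N \<bullet> \<nu> = 0"
    using zero unit orth by (auto simp: r_def e inner_diff lor_inner)
  then have in2: "r \<bullet> T = 0" "r \<bullet> N = 0" "r \<bullet> \<nu> = 0" "N \<bullet> T = 0" "\<nu> \<bullet> T = 0" "\<nu> \<bullet> N = 0"
    by (simp_all add: inner_commute)
  let ?B = "{e, r, T, N, \<nu>}"
  have ne: "e \<noteq> r" "e \<noteq> T" "e \<noteq> N" "e \<noteq> \<nu>" "r \<noteq> T" "r \<noteq> N" "r \<noteq> \<nu>" "T \<noteq> N" "T \<noteq> \<nu>" "N \<noteq> \<nu>"
    using r in1 in2 e(3) zero by auto
  have "x \<bullet> y = (if x = y then 1 else 0)" if "x \<in> ?B" "y \<in> ?B" for x y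
    using that ne ne [symmetric] r e zero in1 in2 by auto
  then have B: "independent ?B" "card ?B = 5"
    using card_orthonormal [of "[e, r, T, N, \<nu>]" ?B] ne by auto
  then have span: "UNIV \<subseteq> span ?B"
    by (intro card_ge_dim_independent) auto
  define y where "y = x - ((x $ 0) *\<^sub>R e + (x \<bullet> r) *\<^sub>R r + (x \<bullet> T) *\<^sub>R T + (x \<bullet> N) *\<^sub>R N + (x \<bullet> \<nu>) *\<^sub>R \<nu>)"
  have "orthogonal y b" if "b \<in> ?B" for b
    using that r in1 in2 zero
    by (auto simp: y_def orthogonal_def inner_diff_left inner_add_left e)
  then have "orthogonal y y"
    using orthogonal_to_span [of y ?B y] span by auto
  then have "y = 0"
    by (simp add: orthogonal_self)
  moreover have "x \<bullet> r = lor x p + x $ 0"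
    using p' by (simp add: r_def inner_diff e lor_inner)
  ultimately show ?thesis
    using zero unfolding y_def
    by (simp add: lor_eq_inner r_def e_def [symmetric] algebra_simps)
qed

subsection \<open>Surfaces and their principal curvatures\<close>

text \<open>Completing the square: a nonpositive value at \<open>k\<close> forces a nonnegative
  discriminant and bounds the distance from \<open>k\<close> to the vertex. The polynomial will be
  the characteristic polynomial of the shape operator, its roots the principal curvatures.\<close>

lemma quadratic_roots_enclose:
  fixes a b c k :: real
  assumes "a > 0" "a * k\<^sup>2 + b * k + c \<le> 0"
  obtains k1 k2 where "k1 \<le> k" "k \<le> k2" "a * k1\<^sup>2 + b * k1 + c = 0" "a * k2\<^sup>2 + b * k2 + c = 0"
proof -
  have sq: "4 * a * (a * x\<^sup>2 + b * x + c) = (2 * a * x + b)\<^sup>2 - (b\<^sup>2 - 4 * a * c)" for x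
    by (simp add: power2_eq_square algebra_simps)
  define d where "d = sqrt (b\<^sup>2 - 4 * a * c)"
  have "4 * a * (a * k\<^sup>2 + b * k + c) \<le> 0"
    using assms by (simp add: mult_le_0_iff)
  then have le: "(2 * a * k + b)\<^sup>2 \<le> b\<^sup>2 - 4 * a * c"
    using sq [of k] by linarith
  then have d: "d\<^sup>2 = b\<^sup>2 - 4 * a * c"
    unfolding d_def using zero_le_power2 order_trans real_sqrt_pow2 by blast
  have "\<bar>2 * a * k + b\<bar> \<le> d"
    unfolding d_def using le by (simp add: real_le_rsqrt)
  then have "(- b - d) / (2 * a) \<le> k" "k \<le> (- b + d) / (2 * a)"
    using \<open>a > 0\<close> by (auto simp: field_simps abs_le_iff)
  moreover have "a * x\<^sup>2 + b * x + c = 0" if "2 * a * x + b = d \<or> 2 * a * x + b = - d" for x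
    using sq [of x] d that \<open>a > 0\<close> by auto
  moreover have "2 * a * ((- b - d) / (2 * a)) + b = - d" "2 * a * ((- b + d) / (2 * a)) + b = d"
    using \<open>a > 0\<close> by (auto simp: field_simps)
  ultimately show ?thesis
    using that by blast
qed

lemma singular_2x2:
  fixes p q r s :: real
  assumes "p * s = q * r"
  obtains x y where "(x, y) \<noteq> (0, 0)" "x * p + y * r = 0" "x * q + y * s = 0"
proof (cases "r = 0 \<and> p = 0")
  case True
  show ?thesis
  proof (cases "s = 0 \<and> q = 0")
    case True
    with \<open>r = 0 \<and> p = 0\<close> show ?thesis using that [of 1 0] by simp
  next
    case False
    with \<open>r = 0 \<and> p = 0\<close> show ?thesis using that [of s "- q"] by auto
  qed
next
  case False
  with assms show ?thesis using that [of r "- p"] by (auto simp: algebra_simps)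
qed

locale surface =
  fixes M :: "(real^5) set" and n :: "real^5 \<Rightarrow> real^5"
  assumes surface: "smooth_surface M" and normal: "unit_normal_field M n"
begin

lemma in_S3: "p \<in> M \<Longrightarrow> p \<in> S3"
  using surface by (auto simp: smooth_surface_def)

lemma lor_self: "p \<in> M \<Longrightarrow> lor p p = 0" and nth_0: "p \<in> M \<Longrightarrow> p $ 0 = 1"
  using in_S3 by (auto simp: S3_def)

lemma normal_unit:
  assumes "p \<in> M"
  shows "n p $ 0 = 0" "lor (n p) p = 0" "lor (n p) (n p) = 1"
  using normal assms tangent_space_S3 unfolding unit_normal_field_def by blast+

lemma tangent_space_subset: "p \<in> M \<Longrightarrow> tangent_space M p \<subseteq> tangent_plane p (n p)"
proof
  fix v assume p: "p \<in> M" and v: "v \<in> tangent_space M p"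
  then have "v \<in> tangent_space S3 p"
    using tangent_space_mono in_S3 by blast
  moreover have "lor (n p) v = 0"
    using normal p v unfolding unit_normal_field_def by blast
  ultimately show "v \<in> tangent_plane p (n p)"
    using tangent_space_S3 by (simp add: tangent_plane_def lor_commute [of v "n p"])
qed

lemma curve_tangent:
  assumes "\<forall>\<^sub>F s in nhds s0. \<gamma> s \<in> M" "(\<gamma> has_vector_derivative v) (at s0)"
  shows "v \<in> tangent_space M (\<gamma> s0)"
proof -
  have "((\<lambda>s. \<gamma> (s0 + s)) has_vector_derivative v) (at 0)"
  proof -
    have "((\<lambda>s. s0 + s) has_vector_derivative 1) (at 0)"
      by (auto intro!: derivative_eq_intros)
    then show ?thesis
      using vector_diff_chain_at [of "\<lambda>s. s0 + s" 1 0 \<gamma> v] assms(2) by (simp add: o_def)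
  qed
  moreover have "\<forall>\<^sub>F s in nhds 0. \<gamma> (s0 + s) \<in> M"
  proof -
    have "((\<lambda>s. s0 + s) \<longlongrightarrow> s0 + 0) (nhds (0::real))"
      by (intro tendsto_intros filterlim_ident)
    then show ?thesis
      using assms(1) by (auto dest: filterlim_iff [THEN iffD1])
  qed
  ultimately show ?thesis
    unfolding tangent_space_def by (intro CollectI exI [of _ "\<lambda>s. \<gamma> (s0 + s)"]) simp
qed

text \<open>The range of the chart differential consists of velocities in M, and these lie in
  \<open>tangent_plane\<close>. The differential is injective, so a dimension count closes the chain
  and all three spaces coincide.\<close>

lemma chart:
  assumes "p \<in> M"
  obtains W :: "(real^2) set" and f w0 where "open W" "smooth_on f W" "w0 \<in> W" "f w0 = p" "f ` W \<subseteq> M"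
    "\<And>w. w \<in> W \<Longrightarrow> inj (frechet_derivative f (at w))"
    "\<And>w. w \<in> W \<Longrightarrow> range (frechet_derivative f (at w)) = tangent_plane (f w) (n (f w))"
    "\<And>w. w \<in> W \<Longrightarrow> tangent_space M (f w) = tangent_plane (f w) (n (f w))"
proof -
  obtain W :: "(real^2) set" and f where W: "open W" "smooth_on f W"
    "\<And>w. w \<in> W \<Longrightarrow> inj (frechet_derivative f (at w))"
    and p: "p \<in> f ` W" and oi: "openin (top_of_set M) (f ` W)"
    using surface assms unfolding smooth_surface_def by blast
  from oi have fM: "f ` W \<subseteq> M"
    using openin_imp_subset by blast
  have sub: "range (frechet_derivative f (at w)) \<subseteq> tangent_space M (f w)" if "w \<in> W" for w
  proof clarify
    fix a
    have "\<forall>\<^sub>F s in nhds 0. w + s *\<^sub>R a \<in> W"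
    proof -
      have "((\<lambda>s. w + s *\<^sub>R a) \<longlongrightarrow> w + 0 *\<^sub>R a) (nhds (0::real))"
        by (intro tendsto_intros filterlim_ident)
      then show ?thesis
        using topological_tendstoD [OF _ W(1)] that by auto
    qed
    then have "\<forall>\<^sub>F s in nhds 0. f (w + s *\<^sub>R a) \<in> M"
      by (rule eventually_mono) (use fM in blast)
    from curve_tangent [OF this] smooth_on_line [OF W(2), of w 0 a] that
    show "frechet_derivative f (at w) a \<in> tangent_space M (f w)"
      by simp
  qed
  have range: "range (frechet_derivative f (at w)) = tangent_plane (f w) (n (f w))" if "w \<in> W" for w
  proof -
    have "f w \<in> M"
      using fM that by blast
    then show ?thesis
      using sub [OF that] tangent_space_subset W(3) [OF that]
      by (intro tangent_plane_eq_range in_S3 normal_unit linear_frechet_derivative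
          smooth_on_differentiable [OF W(2) that]) blast+
  qed
  have "tangent_space M (f w) = tangent_plane (f w) (n (f w))" if "w \<in> W" for w
    using sub [OF that] range [OF that] tangent_space_subset fM that by blast
  moreover obtain w0 where "w0 \<in> W" "f w0 = p"
    using p by blast
  ultimately show ?thesis
    using that W fM range by blast
qed

lemma tangent_space_eq: "p \<in> M \<Longrightarrow> tangent_space M p = tangent_plane p (n p)"
  using chart by metis

lemma normal_extension:
  assumes "p \<in> M"
  obtains U g where "open U" "p \<in> U" "smooth_on g U" "\<And>x. x \<in> M \<Longrightarrow> x \<in> U \<Longrightarrow> n x = g x"
  using normal assms unfolding unit_normal_field_def smooth_map_on_set_def by (metis IntI)

text \<open>The values of \<open>n\<close> off M carry no information. Along a curve in M it may be
  replaced by a smooth extension \<open>g\<close>, which also shows that its derivative is linear in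
  the velocity.\<close>

lemma normal_has_vector_derivative:
  assumes g: "open U" "smooth_on g U" "\<And>x. x \<in> M \<Longrightarrow> x \<in> U \<Longrightarrow> n x = g x"
    and \<gamma>: "\<forall>\<^sub>F s in nhds s0. \<gamma> s \<in> M" "(\<gamma> has_vector_derivative v) (at s0)" "\<gamma> s0 \<in> U"
  shows "((\<lambda>s. n (\<gamma> s)) has_vector_derivative frechet_derivative g (at (\<gamma> s0)) v) (at s0)"
proof -
  have "(\<gamma> \<longlongrightarrow> \<gamma> s0) (nhds s0)"
    using has_vector_derivative_continuous [OF \<gamma>(2)] tendsto_at_iff_tendsto_nhds [of \<gamma> s0]
    by (simp add: isCont_def)
  then have "\<forall>\<^sub>F s in nhds s0. \<gamma> s \<in> U"
    using topological_tendstoD g(1) \<gamma>(3) by blast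
  with \<gamma>(1) have "\<forall>\<^sub>F s in nhds s0. g (\<gamma> s) = n (\<gamma> s)"
    by eventually_elim (simp add: g(3))
  then show ?thesis
    using has_vector_derivative_cong_ev [of UNIV "\<lambda>s. g (\<gamma> s)" "\<lambda>s. n (\<gamma> s)" s0]
      smooth_on_chain [of \<gamma> v s0 g U] g(2) \<gamma> eventually_nhds_x_imp_x by fastforce
qed

lemma normal_derivative_tangent:
  assumes "\<forall>\<^sub>F s in nhds s0. \<gamma> s \<in> M" "(\<gamma> has_vector_derivative v) (at s0)"
    and "((\<lambda>s. n (\<gamma> s)) has_vector_derivative v') (at s0)"
  shows "v' \<in> tangent_plane (\<gamma> s0) (n (\<gamma> s0))"
proof -
  have p: "\<gamma> s0 \<in> M"
    using assms(1) eventually_nhds_x_imp_x by blast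
  have v: "lor (n (\<gamma> s0)) v = 0"
    using curve_tangent [OF assms(1,2)] tangent_space_subset p by (auto simp: tangent_plane_def lor_commute)
  have "v' $ 0 = 0"
    by (rule has_vector_derivative_eventually_const [OF nth_has_vector_derivative [OF assms(3)]])
       (use assms(1) in \<open>auto simp: normal_unit elim: eventually_mono\<close>)
  moreover have "lor (n (\<gamma> s0)) v + lor v' (\<gamma> s0) = 0"
    by (rule has_vector_derivative_eventually_const [OF lor.has_vector_derivative [OF assms(3,2)]])
       (use assms(1) in \<open>auto simp: normal_unit elim: eventually_mono\<close>)
  moreover have "lor (n (\<gamma> s0)) v' + lor v' (n (\<gamma> s0)) = 0"
    by (rule has_vector_derivative_eventually_const [OF lor.has_vector_derivative [OF assms(3,3)]])
       (use assms(1) in \<open>auto simp: normal_unit elim: eventually_mono\<close>)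
  ultimately show ?thesis
    using v by (simp add: tangent_plane_def lor_commute)
qed

section \<open>Tangent vectors and points of V(M)\<close>

lemma V_tangent_orthogonal:
  assumes "w \<in> V_tangent M n (p, k)"
  shows "lor p w = 0"
proof -
  obtain \<gamma> where \<gamma>: "\<gamma> 0 = (p, k)" "\<forall>\<^sub>F s in nhds 0. \<gamma> s \<in> V_dom M n" "\<gamma> differentiable (at 0)"
    and w: "((\<lambda>s. V_map n (\<gamma> s)) has_vector_derivative w) (at 0)"
    using assms unfolding V_tangent_def by blast
  define m where "m s = fst (\<gamma> s)" for s
  define v where "v = fst (vector_derivative \<gamma> (at 0))"
  have m0: "m 0 = p"
    by (simp add: m_def \<gamma>(1))
  have m: "(m has_vector_derivative v) (at 0)"
    using bounded_linear.has_vector_derivative [OF bounded_linear_fst] \<gamma>(3) vector_derivative_works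
    unfolding m_def [abs_def] v_def by blast
  have mM: "\<forall>\<^sub>F s in nhds 0. m s \<in> M"
    using \<gamma>(2) by (rule eventually_mono) (auto simp: V_dom_def m_def)
  then have p: "p \<in> M"
    using eventually_nhds_x_imp_x m0 by blast
  have v: "lor v p = 0" "lor v (n p) = 0"
    using curve_tangent [OF mM m] tangent_space_subset p m0 by (auto simp: tangent_plane_def)
  \<comment> \<open>Each sphere along the path passes through its contact point \<open>m s\<close>.
    Differentiating this incidence leaves only the term with \<open>w\<close>, because the sphere at
    0 is tangent to M and hence orthogonal to \<open>v\<close>.\<close>
  have "lor (V_map n (\<gamma> 0)) v + lor w (m 0) = 0"
    by (rule has_vector_derivative_eventually_const [OF lor.has_vector_derivative [OF w m]])
       (use mM in \<open>auto simp: V_map_def m_def lor.add_left lor.scaleR_left normal_unit lor_self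
           split: prod.split elim!: eventually_mono\<close>)
  then show ?thesis
    using v m0 \<gamma>(1)
    by (simp add: V_map_def lor.add_left lor.scaleR_left lor_commute [of p] lor_commute [of "n p"])
qed

text \<open>A vanishing determinant gives a nonzero tangent vector \<open>v\<close> for which
  \<open>X\<close>, k times \<open>v\<close> plus the derivative of the normal along
  \<open>v\<close>, is orthogonal to \<open>f1\<close> and \<open>f2\<close>. As \<open>X\<close> is
  itself tangent, it is orthogonal to itself, and definiteness on tangent vectors gives
  \<open>X = 0\<close>: \<open>v\<close> is an eigenvector.\<close>

lemma principal_curvature_in_chart:
  fixes W :: "(real^2) set"
  assumes W: "open W" "smooth_on f W" "f ` W \<subseteq> M" "w \<in> W"
    and inj: "inj (frechet_derivative f (at w))"
    and range: "range (frechet_derivative f (at w)) = tangent_plane (f w) (n (f w))"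
    and g: "open U" "smooth_on g U" "\<And>x. x \<in> M \<Longrightarrow> x \<in> U \<Longrightarrow> n x = g x" "f w \<in> U"
    and basis: "\<And>a. \<exists>x y. a = x *\<^sub>R a1 + y *\<^sub>R a2"
    and indep: "\<And>x y. x *\<^sub>R a1 + y *\<^sub>R a2 = 0 \<Longrightarrow> x = 0 \<and> y = 0"
    and f: "f1 = frechet_derivative f (at w) a1" "f2 = frechet_derivative f (at w) a2"
    and N: "N1 = frechet_derivative g (at (f w)) f1" "N2 = frechet_derivative g (at (f w)) f2"
    and sing: "(k * lor f1 f1 + lor N1 f1) * (k * lor f2 f2 + lor N2 f2)
             = (k * lor f1 f2 + lor N1 f2) * (k * lor f2 f1 + lor N2 f1)"
  shows "principal_curvature M n (f w) k"
proof -
  let ?Df = "frechet_derivative f (at w)" and ?Dg = "frechet_derivative g (at (f w))"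
  note lin_f = linear_frechet_derivative [OF smooth_on_differentiable [OF W(2,4)]]
  note lin_g = linear_frechet_derivative [OF smooth_on_differentiable [OF g(2,4)]]
  obtain x y where xy: "(x, y) \<noteq> (0, 0)"
    "x * (k * lor f1 f1 + lor N1 f1) + y * (k * lor f2 f1 + lor N2 f1) = 0"
    "x * (k * lor f1 f2 + lor N1 f2) + y * (k * lor f2 f2 + lor N2 f2) = 0"
    using singular_2x2 [OF sing] by blast
  define a where "a = x *\<^sub>R a1 + y *\<^sub>R a2"
  define v where "v = ?Df a"
  have v: "v = x *\<^sub>R f1 + y *\<^sub>R f2"
    by (simp add: v_def a_def f linear_add [OF lin_f] linear_cmul [OF lin_f])
  have Dg_v: "?Dg v = x *\<^sub>R N1 + y *\<^sub>R N2"
    by (simp add: v N linear_add [OF lin_g] linear_cmul [OF lin_g])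
  have "a \<noteq> 0"
    using indep xy(1) unfolding a_def by blast
  then have "v \<noteq> 0"
    using inj linear_0 [OF lin_f] unfolding v_def by (metis injD)
  define \<gamma> where "\<gamma> s = f (w + s *\<^sub>R a)" for s
  have \<gamma>0: "\<gamma> 0 = f w"
    by (simp add: \<gamma>_def)
  have d\<gamma>: "(\<gamma> has_vector_derivative v) (at 0)"
    using smooth_on_line [OF W(2), of w 0 a] W(4) by (simp add: \<gamma>_def [abs_def] v_def)
  have "((\<lambda>s. w + s *\<^sub>R a) \<longlongrightarrow> w + 0 *\<^sub>R a) (nhds (0::real))"
    by (intro tendsto_intros filterlim_ident)
  then have "\<forall>\<^sub>F s in nhds 0. w + s *\<^sub>R a \<in> W"
    using topological_tendstoD [OF _ W(1)] W(4) by auto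
  then have \<gamma>M: "\<forall>\<^sub>F s in nhds 0. \<gamma> s \<in> M"
    by (rule eventually_mono) (use W(3) in \<open>auto simp: \<gamma>_def\<close>)
  have dn: "((\<lambda>s. n (\<gamma> s)) has_vector_derivative ?Dg v) (at 0)"
    using normal_has_vector_derivative [OF g(1-3) \<gamma>M d\<gamma>] g(4) by (simp add: \<gamma>0)
  define X where "X = k *\<^sub>R v + ?Dg v"
  have "?Dg v \<in> tangent_plane (f w) (n (f w))"
    using normal_derivative_tangent [OF \<gamma>M d\<gamma> dn] by (simp add: \<gamma>0)
  moreover have "v \<in> tangent_plane (f w) (n (f w))"
    using range v_def by blast
  ultimately have X: "X \<in> tangent_plane (f w) (n (f w))"
    unfolding X_def by (intro subspace_add subspace_scale tangent_plane_subspace)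
  have "lor X f1 = 0" "lor X f2 = 0"
    using xy(2,3) unfolding X_def Dg_v by (simp_all add: v lor.add_left lor.scaleR_left algebra_simps)
  moreover obtain b where "X = ?Df b"
    using X range by blast
  moreover obtain x' y' where "b = x' *\<^sub>R a1 + y' *\<^sub>R a2"
    using basis by blast
  ultimately have "lor X X = 0"
    by (simp add: linear_add [OF lin_f] linear_cmul [OF lin_f] f [symmetric] lor.add_right lor.scaleR_right)
  then have "X = 0"
    using X by (simp add: tangent_plane_def lor_eq_inner)
  then have "?Dg v = (- k) *\<^sub>R v"
    by (simp add: X_def add_eq_0_iff)
  then show ?thesis
    unfolding principal_curvature_def using \<gamma>0 d\<gamma> \<gamma>M dn \<open>v \<noteq> 0\<close>
    by (intro exI [of _ \<gamma>] exI [of _ v]) simp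
qed

text \<open>The determinant is a positive multiple of the characteristic polynomial of the shape operator
  at \<open>k\<close>, which is nonpositive exactly between the two principal curvatures.\<close>
lemma in_V_dom_in_chart:
  fixes W :: "(real^2) set"
  assumes W: "open W" "smooth_on f W" "f ` W \<subseteq> M" "w \<in> W"
    and inj: "inj (frechet_derivative f (at w))"
    and range: "range (frechet_derivative f (at w)) = tangent_plane (f w) (n (f w))"
    and g: "open U" "smooth_on g U" "\<And>x. x \<in> M \<Longrightarrow> x \<in> U \<Longrightarrow> n x = g x" "f w \<in> U"
    and basis: "\<And>a. \<exists>x y. a = x *\<^sub>R a1 + y *\<^sub>R a2"
    and indep: "\<And>x y. x *\<^sub>R a1 + y *\<^sub>R a2 = 0 \<Longrightarrow> x = 0 \<and> y = 0"
    and f: "f1 = frechet_derivative f (at w) a1" "f2 = frechet_derivative f (at w) a2"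
    and N: "N1 = frechet_derivative g (at (f w)) f1" "N2 = frechet_derivative g (at (f w)) f2"
    and pos: "lor f1 f1 * lor f2 f2 - lor f1 f2 * lor f2 f1 > 0"
    and le: "(k * lor f1 f1 + lor N1 f1) * (k * lor f2 f2 + lor N2 f2)
           - (k * lor f1 f2 + lor N1 f2) * (k * lor f2 f1 + lor N2 f1) \<le> 0"
  shows "(f w, k) \<in> V_dom M n"
proof -
  \<comment> \<open>The leading coefficient is the Gram determinant of \<open>f1\<close>,
    \<open>f2\<close>, which is positive by \<open>pos\<close>, so the polynomial in k opens
    upwards.\<close>
  define A where "A = lor f1 f1 * lor f2 f2 - lor f1 f2 * lor f2 f1"
  define B where "B = lor f1 f1 * lor N2 f2 + lor N1 f1 * lor f2 f2 - lor f1 f2 * lor N2 f1 - lor N1 f2 * lor f2 f1"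
  define C where "C = lor N1 f1 * lor N2 f2 - lor N1 f2 * lor N2 f1"
  have quad: "(k * lor f1 f1 + lor N1 f1) * (k * lor f2 f2 + lor N2 f2)
           - (k * lor f1 f2 + lor N1 f2) * (k * lor f2 f1 + lor N2 f1) = A * k\<^sup>2 + B * k + C" for k
    by (simp add: A_def B_def C_def power2_eq_square algebra_simps)
  obtain k1 k2 where "k1 \<le> k" "k \<le> k2" "A * k1\<^sup>2 + B * k1 + C = 0" "A * k2\<^sup>2 + B * k2 + C = 0"
    using quadratic_roots_enclose [of A k B C] pos le quad [of k] unfolding A_def by metis
  moreover have "principal_curvature M n (f w) k'" if "A * k'\<^sup>2 + B * k' + C = 0" for k'
    using quad [of k'] that
    by (intro principal_curvature_in_chart [OF W inj range g basis indep f N]) simp_all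
  moreover have "f w \<in> M"
    using W by blast
  ultimately show ?thesis
    unfolding V_dom_def by blast
qed

end

subsection \<open>The Darboux frame of a curve\<close>

locale surface_curve = surface M n for M n +
  fixes c N1 :: "real \<Rightarrow> real^5" and I :: "real set"
  assumes curve: "unit_speed_curve M c I" and frame: "darboux_normal M n c I N1"
begin

abbreviation T where "T \<equiv> unit_tangent c"
abbreviation \<nu> where "\<nu> \<equiv> \<lambda>t. n (c t)"
definition c2 where "c2 t = vector_derivative T (at t)"
definition c3 where "c3 t = vector_derivative c2 (at t)"
definition \<nu>' where "\<nu>' t = vector_derivative \<nu> (at t)"
abbreviation kn where "kn \<equiv> normal_curvature n c"
abbreviation kg where "kg \<equiv> geodesic_curvature c N1"
abbreviation \<tau> where "\<tau> \<equiv> geodesic_torsion n c N1"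

lemma open_I: "open I"
  using curve by (simp add: unit_speed_curve_def)

lemma eventually_I: "t \<in> I \<Longrightarrow> \<forall>\<^sub>F s in nhds t. s \<in> I"
  using eventually_nhds_in_open open_I by blast

lemma eventually_c: "t \<in> I \<Longrightarrow> \<forall>\<^sub>F s in nhds t. c s \<in> M"
  using eventually_I by (rule eventually_mono) (use curve in \<open>auto simp: unit_speed_curve_def\<close>)

lemma c_in: "t \<in> I \<Longrightarrow> c t \<in> M"
  using curve by (auto simp: unit_speed_curve_def)

lemma smooth_c: "smooth_on c I" and smooth_T: "smooth_on T I" and smooth_c2: "smooth_on c2 I"
proof -
  show c: "smooth_on c I"
    using curve by (simp add: unit_speed_curve_def)
  show T: "smooth_on T I"
    using smooth_on_vector_derivative [OF open_I c] by (simp add: unit_tangent_def [abs_def])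
  show "smooth_on c2 I"
    using smooth_on_vector_derivative [OF open_I T] by (simp add: c2_def [abs_def])
qed

lemma derivs:
  assumes "t \<in> I"
  shows "(c has_vector_derivative T t) (at t)" "(T has_vector_derivative c2 t) (at t)"
    "(c2 has_vector_derivative c3 t) (at t)"
  using smooth_on_has_vector_derivative [OF smooth_c assms] smooth_on_has_vector_derivative [OF smooth_T assms]
    smooth_on_has_vector_derivative [OF smooth_c2 assms]
  by (simp_all add: unit_tangent_def c2_def c3_def)

lemma normal_deriv_local:
  assumes "t \<in> I" "open U" "smooth_on g U" "\<And>x. x \<in> M \<Longrightarrow> x \<in> U \<Longrightarrow> n x = g x" "c t \<in> U"
  shows "(\<nu> has_vector_derivative frechet_derivative g (at (c t)) (T t)) (at t)"
  using normal_has_vector_derivative [OF assms(2-4) eventually_c derivs(1)] assms(1,5) by blast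

lemma normal_deriv: "t \<in> I \<Longrightarrow> (\<nu> has_vector_derivative \<nu>' t) (at t)"
proof -
  assume t: "t \<in> I"
  obtain U g where "open U" "c t \<in> U" "smooth_on g U" "\<And>x. x \<in> M \<Longrightarrow> x \<in> U \<Longrightarrow> n x = g x"
    using normal_extension [OF c_in [OF t]] by blast
  with normal_deriv_local [OF t] have "(\<nu> has_vector_derivative frechet_derivative g (at (c t)) (T t)) (at t)"
    by blast
  then show "(\<nu> has_vector_derivative \<nu>' t) (at t)"
    by (simp add: \<nu>'_def vector_derivative_at)
qed

text \<open>On an open piece of \<open>I\<close> where \<open>c\<close> stays in the domain of one
  extension \<open>g\<close>, the derivative is that of \<open>g\<close> at \<open>c\<close> applied
  to \<open>T\<close>, which is jointly continuous. It is used for the continuity of \<tau>.\<close>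

lemma continuous_normal_deriv: "continuous_on I \<nu>'"
proof (intro continuous_at_imp_continuous_on ballI)
  fix t assume t: "t \<in> I"
  obtain U g where g: "open U" "c t \<in> U" "smooth_on g U" "\<And>x. x \<in> M \<Longrightarrow> x \<in> U \<Longrightarrow> n x = g x"
    using normal_extension [OF c_in [OF t]] by blast
  define S where "S = I \<inter> c -` U"
  have "open S"
    unfolding S_def by (rule continuous_open_preimage [OF smooth_on_continuous_on [OF smooth_c] open_I g(1)])
  have "\<nu>' s = frechet_derivative g (at (c s)) (T s)" if "s \<in> S" for s
    using normal_deriv_local [of s U g] g that unfolding S_def \<nu>'_def
    by (intro vector_derivative_at) auto
  moreover have "continuous_on S (\<lambda>s. frechet_derivative g (at (c s)) (T s))"
    using smooth_on_continuous_on [OF smooth_c] smooth_on_continuous_on [OF smooth_T]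
    by (intro continuous_on_frechet_derivative [OF g(3)])
       (auto simp: S_def intro: continuous_on_subset)
  ultimately have "continuous_on S \<nu>'"
    by (simp cong: continuous_on_cong)
  then show "isCont \<nu>' t"
    using \<open>open S\<close> t g(2) by (simp add: continuous_on_eq_continuous_at S_def)
qed

lemma constant_on_I:
  assumes "(f has_vector_derivative d) (at t)" "t \<in> I" "\<And>s. s \<in> I \<Longrightarrow> f s = k"
  shows "d = 0"
  by (rule has_vector_derivative_eventually_const [OF assms(1) eventually_mono [OF eventually_I]])
     (use assms in auto)

lemma tangent_I:
  assumes "t \<in> I"
  shows "T t \<in> tangent_plane (c t) (\<nu> t)" "N1 t \<in> tangent_plane (c t) (\<nu> t)"
  using curve_tangent [OF eventually_c derivs(1)] tangent_space_eq [OF c_in] frame assms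
  by (auto simp: darboux_normal_def)

lemma frame_I:
  assumes "t \<in> I"
  shows "lor (c t) (c t) = 0" "c t $ 0 = 1" "T t $ 0 = 0" "N1 t $ 0 = 0" "\<nu> t $ 0 = 0"
    "lor (T t) (T t) = 1" "lor (N1 t) (N1 t) = 1" "lor (\<nu> t) (\<nu> t) = 1"
    "lor (T t) (c t) = 0" "lor (N1 t) (c t) = 0" "lor (\<nu> t) (c t) = 0"
    "lor (T t) (N1 t) = 0" "lor (T t) (\<nu> t) = 0" "lor (N1 t) (\<nu> t) = 0"
    "lor (c t) (T t) = 0" "lor (c t) (N1 t) = 0" "lor (c t) (\<nu> t) = 0"
    "lor (N1 t) (T t) = 0" "lor (\<nu> t) (T t) = 0" "lor (\<nu> t) (N1 t) = 0"
proof -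
  show 1: "lor (c t) (c t) = 0" "c t $ 0 = 1" "lor (\<nu> t) (\<nu> t) = 1" "\<nu> t $ 0 = 0" "lor (\<nu> t) (c t) = 0"
    using lor_self nth_0 normal_unit c_in [OF assms] by auto
  show 2: "T t $ 0 = 0" "N1 t $ 0 = 0" "lor (T t) (c t) = 0" "lor (N1 t) (c t) = 0"
     "lor (T t) (\<nu> t) = 0" "lor (N1 t) (\<nu> t) = 0"
    using tangent_I [OF assms] by (auto simp: tangent_plane_def)
  show 3: "lor (T t) (T t) = 1" "lor (N1 t) (N1 t) = 1" "lor (N1 t) (T t) = 0"
    using curve frame assms by (auto simp: unit_speed_curve_def darboux_normal_def unit_tangent_def)
  show "lor (T t) (N1 t) = 0"
    "lor (c t) (T t) = 0" "lor (c t) (N1 t) = 0" "lor (c t) (\<nu> t) = 0"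
    "lor (\<nu> t) (T t) = 0" "lor (\<nu> t) (N1 t) = 0"
    using 1 2 3 by (simp_all add: lor_commute [of "c t" "T t"] lor_commute [of "c t" "N1 t"] lor_commute [of "c t" "\<nu> t"]
        lor_commute [of "\<nu> t" "T t"] lor_commute [of "\<nu> t" "N1 t"] lor_commute [of "T t" "N1 t"])
qed

lemma expansion_I:
  assumes "t \<in> I"
  shows "x = (x $ 0) *\<^sub>R c t + lor x (c t) *\<^sub>R (c t - axis 0 1) + lor x (T t) *\<^sub>R T t
    + lor x (N1 t) *\<^sub>R N1 t + lor x (\<nu> t) *\<^sub>R \<nu> t"
  by (rule frame_expansion) (use frame_I [OF assms] in_S3 [OF c_in [OF assms]] in auto)

text \<open>The projection subtracts a multiple of \<open>c t - axis 0 1\<close>, which is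
  orthogonal to \<open>v\<close>. The three curvatures can therefore be computed with ordinary
  derivatives.\<close>

lemma lor_cov_deriv:
  assumes "v $ 0 = 0" "lor (c t) v = 0"
  shows "lor (cov_deriv c X t) v = lor (vector_derivative X (at t)) v"
  using assms by (simp add: cov_deriv_def lor.diff_left lor.scaleR_left lor_origin)

lemma curvatures:
  assumes "t \<in> I"
  shows "kn t = lor (c2 t) (\<nu> t)" "kg t = lor (c2 t) (N1 t)" "\<tau> t = - lor (\<nu>' t) (N1 t)"
  using frame_I [OF assms]
  by (simp_all add: normal_curvature_def geodesic_curvature_def geodesic_torsion_def lor_cov_deriv c2_def \<nu>'_def)

lemma c2_products:
  assumes t: "t \<in> I"
  shows "c2 t $ 0 = 0" "lor (c2 t) (T t) = 0" "lor (c2 t) (c t) = - 1"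
proof -
  show "c2 t $ 0 = 0"
    by (rule constant_on_I [OF nth_has_vector_derivative [OF derivs(2)] t]) (use t frame_I in auto)
  have "lor (T t) (c2 t) + lor (c2 t) (T t) = 0"
    by (rule constant_on_I [OF lor.has_vector_derivative [OF derivs(2) derivs(2)] t]) (use t frame_I in auto)
  then show "lor (c2 t) (T t) = 0"
    by (simp add: lor_commute)
  have "lor (T t) (T t) + lor (c2 t) (c t) = 0"
    by (rule constant_on_I [OF lor.has_vector_derivative [OF derivs(2) derivs(1)] t]) (use t frame_I in auto)
  then show "lor (c2 t) (c t) = - 1"
    using frame_I t by simp
qed

lemma c3_products:
  assumes t: "t \<in> I"
  shows "lor (c3 t) (c t) = 0"
proof -
  have "lor (c2 t) (T t) + lor (c3 t) (c t) = 0"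
    by (rule constant_on_I [OF lor.has_vector_derivative [OF derivs(3) derivs(1)] t]) (use t c2_products in auto)
  then show ?thesis
    using c2_products t by simp
qed

lemma normal_deriv_products:
  assumes t: "t \<in> I"
  shows "\<nu>' t \<in> tangent_plane (c t) (\<nu> t)" "lor (\<nu>' t) (T t) = - kn t"
    "\<nu>' t = - kn t *\<^sub>R T t - \<tau> t *\<^sub>R N1 t"
proof -
  show tan: "\<nu>' t \<in> tangent_plane (c t) (\<nu> t)"
    using normal_derivative_tangent [OF eventually_c derivs(1) normal_deriv] t by blast
  have "lor (\<nu> t) (c2 t) + lor (\<nu>' t) (T t) = 0"
    by (rule constant_on_I [OF lor.has_vector_derivative [OF normal_deriv derivs(2)] t]) (use t frame_I in auto)
  then show 1: "lor (\<nu>' t) (T t) = - kn t"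
    using curvatures t by (simp add: lor_commute)
  have "\<nu>' t = lor (\<nu>' t) (T t) *\<^sub>R T t + lor (\<nu>' t) (N1 t) *\<^sub>R N1 t"
    using expansion_I [OF t, of "\<nu>' t"] tan by (simp add: tangent_plane_def)
  then show "\<nu>' t = - kn t *\<^sub>R T t - \<tau> t *\<^sub>R N1 t"
    using 1 curvatures t by simp
qed

lemma kn_deriv:
  assumes t: "t \<in> I"
  shows "(kn has_real_derivative lor (c3 t) (\<nu> t) - \<tau> t * kg t) (at t)"
proof -
  have "lor (c2 t) (\<nu>' t) = - \<tau> t * kg t"
    using c2_products [OF t] curvatures [OF t]
    by (subst normal_deriv_products(3) [OF t]) (simp add: lor.diff_right lor.scaleR_right lor.minus_right)
  then have "((\<lambda>s. lor (c2 s) (\<nu> s)) has_vector_derivative lor (c3 t) (\<nu> t) - \<tau> t * kg t) (at t)"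
    using lor.has_vector_derivative [OF derivs(3) normal_deriv] t by fastforce
  moreover have "\<forall>\<^sub>F s in nhds t. lor (c2 s) (\<nu> s) = kn s"
    using eventually_I [OF t] by (rule eventually_mono) (simp add: curvatures)
  ultimately show ?thesis
    using has_vector_derivative_cong_ev [of UNIV "\<lambda>s. lor (c2 s) (\<nu> s)" kn t] eventually_nhds_x_imp_x
    by (fastforce simp: has_real_derivative_iff_has_vector_derivative)
qed

lemma deriv_kn: "t \<in> I \<Longrightarrow> deriv kn t + \<tau> t * kg t = lor (c3 t) (\<nu> t)"
  using DERIV_imp_deriv [OF kn_deriv] by simp

subsection \<open>Osculating spheres\<close>

lemma contact_order_3_iff:
  assumes t: "t \<in> I"
  shows "contact_order_ge 3 c t \<sigma> \<longleftrightarrow>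
    lor \<sigma> (c t) = 0 \<and> lor \<sigma> (T t) = 0 \<and> lor \<sigma> (c2 t) = 0 \<and> lor \<sigma> (c3 t) = 0"
proof -
  \<comment> \<open>An iterated \<open>deriv\<close> depends only on values near the point. As
    \<open>I\<close> is open, a formula for one derivative on all of \<open>I\<close> can be
    differentiated again.\<close>
  have step: "deriv G s = lor \<sigma> (X' s)"
    if "s \<in> I" "(X has_vector_derivative X' s) (at s)" "\<And>r. r \<in> I \<Longrightarrow> G r = lor \<sigma> (X r)" for G X X' s
  proof -
    have "deriv G s = deriv (\<lambda>r. lor \<sigma> (X r)) s"
      using eventually_I [OF that(1)] that(3) by (intro deriv_cong_ev) (auto elim: eventually_mono)
    also have "\<dots> = lor \<sigma> (X' s)"
      using bounded_linear.has_vector_derivative [OF lor.bounded_linear_right that(2)]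
      by (intro DERIV_imp_deriv) (simp add: has_real_derivative_iff_has_vector_derivative)
    finally show ?thesis .
  qed
  let ?G = "\<lambda>s. lor \<sigma> (c s)"
  have 1: "deriv ?G s = lor \<sigma> (T s)" if "s \<in> I" for s
    using step [of s c T ?G] derivs that by simp
  have 2: "deriv (deriv ?G) s = lor \<sigma> (c2 s)" if "s \<in> I" for s
    using step [of s T c2 "deriv ?G"] derivs that 1 by simp
  have 3: "deriv (deriv (deriv ?G)) s = lor \<sigma> (c3 s)" if "s \<in> I" for s
    using step [of s c2 c3 "deriv (deriv ?G)"] derivs that 2 by simp
  have "{..3::nat} = {0, 1, 2, 3}"
    by auto
  then have "(\<forall>j\<le>3. P j) \<longleftrightarrow> P 0 \<and> P 1 \<and> P 2 \<and> P (3::nat)" for P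
    by (metis atMost_iff insert_iff empty_iff)
  then show ?thesis
    using 1 2 3 t unfolding contact_order_ge_def
    by (simp add: eval_nat_numeral)
qed

text \<open>Tangency leaves \<sigma> in the span of \<open>c t\<close> and \<open>\<nu> t\<close>.
  Since \<open>c t\<close> is light-like and orthogonal to \<open>\<nu> t\<close>, the condition
  \<open>lor \<sigma> \<sigma> = 1\<close> makes the second coefficient nonzero; since
  \<open>c3 t\<close> is orthogonal to \<open>c t\<close>, the pairing of \<sigma> with
  \<open>c3 t\<close> sees this coefficient alone.\<close>

lemma darboux_at_iff:
  assumes t: "t \<in> I"
  shows "(\<exists>\<sigma>. osculating_sphere c t \<sigma> \<and> sphere_tangent_to \<sigma> M (c t)) \<longleftrightarrow> lor (c3 t) (\<nu> t) = 0"
proof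
  assume "\<exists>\<sigma>. osculating_sphere c t \<sigma> \<and> sphere_tangent_to \<sigma> M (c t)"
  then obtain \<sigma> where \<sigma>: "lor \<sigma> \<sigma> = 1" "lor \<sigma> (c t) = 0" "lor \<sigma> (T t) = 0" "lor \<sigma> (c3 t) = 0"
    and tan: "tangent_space (sphere_of \<sigma>) (c t) = tangent_space M (c t)"
    by (auto simp: osculating_sphere_def contact_order_3_iff [OF t] sphere_tangent_to_def Lambda4_def)
  have "lor \<sigma> (N1 t) = 0"
    using tangent_space_sphere_of tan tangent_I [OF t] tangent_space_eq [OF c_in [OF t]] by blast
  then have \<sigma>_eq: "\<sigma> = (\<sigma> $ 0) *\<^sub>R c t + lor \<sigma> (\<nu> t) *\<^sub>R \<nu> t"
    using expansion_I [OF t, of \<sigma>] \<sigma> by simp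
  have "lor \<sigma> \<sigma> = lor \<sigma> (\<nu> t) * lor \<sigma> (\<nu> t)"
    using \<sigma> by (subst (2) \<sigma>_eq) (simp add: lor.add_right lor.scaleR_right)
  then have "lor \<sigma> (\<nu> t) \<noteq> 0"
    using \<sigma> by auto
  moreover have "lor \<sigma> (c3 t) = lor \<sigma> (\<nu> t) * lor (c3 t) (\<nu> t)"
    using c3_products [OF t]
    by (subst \<sigma>_eq) (simp add: lor.add_right lor.scaleR_right lor_commute [of _ "c3 t"])
  ultimately show "lor (c3 t) (\<nu> t) = 0"
    using \<sigma> by simp
next
  note fr = frame_I [OF t]
  assume c3: "lor (c3 t) (\<nu> t) = 0"
  define \<sigma> where "\<sigma> = kn t *\<^sub>R c t + \<nu> t"
  have "lor \<sigma> \<sigma> = 1" "lor \<sigma> (c t) = 0" "lor \<sigma> (T t) = 0"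
    using fr by (simp_all add: \<sigma>_def lor.add_left lor.scaleR_left lor.add_right lor.scaleR_right)
  moreover have "lor \<sigma> (c2 t) = 0" "lor \<sigma> (c3 t) = 0"
    using c2_products [OF t] c3_products [OF t] curvatures [OF t] c3
    by (simp_all add: \<sigma>_def lor.add_right lor.scaleR_right lor_commute [of _ "c3 t"] lor_commute [of _ "c2 t"])
  ultimately have "osculating_sphere c t \<sigma>"
    by (simp add: osculating_sphere_def Lambda4_def contact_order_3_iff [OF t])
  moreover have "sphere_tangent_to \<sigma> M (c t)"
    using tangent_plane_sphere_of [OF in_S3 [OF c_in [OF t]], of "\<nu> t" "kn t"] fr
      tangent_space_eq [OF c_in [OF t]] c_in [OF t] in_S3 \<open>lor \<sigma> (c t) = 0\<close>
    by (simp add: sphere_tangent_to_def sphere_of_def \<sigma>_def)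
  ultimately show "\<exists>\<sigma>. osculating_sphere c t \<sigma> \<and> sphere_tangent_to \<sigma> M (c t)"
    by blast
qed

lemma darboux_curve_iff:
  assumes "J \<subseteq> I"
  shows "darboux_curve M c J \<longleftrightarrow> (\<forall>t\<in>J. deriv kn t + \<tau> t * kg t = 0)"
  unfolding darboux_curve_def using darboux_at_iff deriv_kn assms by (metis subsetD)

subsection \<open>The canonical section\<close>

text \<open>Both claims rest on one determinant \<open>q\<close>, taken in chart directions that map
  to \<open>T\<close> and \<open>N1\<close> at the contact point. Its value there is minus the
  square of \<tau>: nonpositive places k_n in the closed interval, and strictly negative keeps
  nearby contact points with the same k inside \<open>V_dom\<close>.\<close>

lemma shape_operator:
  assumes t: "t \<in> I"
  shows "(c t, kn t) \<in> V_dom M n"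
    and "\<tau> t \<noteq> 0 \<Longrightarrow> \<exists>y. - \<tau> t *\<^sub>R T t + y *\<^sub>R N1 t \<in> V_tangent M n (c t, kn t)"
proof -
  note fr = frame_I [OF t]
  obtain W :: "(real^2) set" and f w0 where W: "open W" "smooth_on f W" "f ` W \<subseteq> M"
    and w0: "w0 \<in> W" "f w0 = c t"
    and inj: "\<And>w. w \<in> W \<Longrightarrow> inj (frechet_derivative f (at w))"
    and range: "\<And>w. w \<in> W \<Longrightarrow> range (frechet_derivative f (at w)) = tangent_plane (f w) (n (f w))"
    using chart [OF c_in [OF t]] by metis
  obtain U g where g: "open U" "smooth_on g U" "\<And>x. x \<in> M \<Longrightarrow> x \<in> U \<Longrightarrow> n x = g x" and U: "c t \<in> U"
    using normal_extension [OF c_in [OF t]] by metis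
  define Df where "Df a w = frechet_derivative f (at w) a" for a w
  define DN where "DN a w = frechet_derivative g (at (f w)) (Df a w)" for a w
  have lin: "linear (\<lambda>a. Df a w)" if "w \<in> W" for w
    using linear_frechet_derivative [OF smooth_on_differentiable [OF W(2) that]] by (simp add: Df_def [abs_def])
  have "T t \<in> range (\<lambda>a. Df a w0)" "N1 t \<in> range (\<lambda>a. Df a w0)"
    using range [OF w0(1)] tangent_I [OF t] w0(2) by (simp_all add: Df_def)
  then obtain a1 a2 where a: "Df a1 w0 = T t" "Df a2 w0 = N1 t"
    by (metis imageE)
  have Df_comb: "Df (x *\<^sub>R a1 + y *\<^sub>R a2) w0 = x *\<^sub>R T t + y *\<^sub>R N1 t" for x y
    using linear_add [OF lin [OF w0(1)]] linear_cmul [OF lin [OF w0(1)]] a by simp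
  have basis: "\<exists>x y. a = x *\<^sub>R a1 + y *\<^sub>R a2" for a
  proof -
    have "Df a w0 \<in> tangent_plane (c t) (\<nu> t)"
      using range [OF w0(1)] w0(2) by (auto simp: Df_def)
    then have "Df a w0 = lor (Df a w0) (T t) *\<^sub>R T t + lor (Df a w0) (N1 t) *\<^sub>R N1 t"
      using expansion_I [OF t, of "Df a w0"] by (simp add: tangent_plane_def)
    then have "Df a w0 = Df (lor (Df a w0) (T t) *\<^sub>R a1 + lor (Df a w0) (N1 t) *\<^sub>R a2) w0"
      by (simp only: Df_comb)
    then show ?thesis
      using inj [OF w0(1)] unfolding Df_def by (blast dest: injD)
  qed
  have indep: "x = 0 \<and> y = 0" if "x *\<^sub>R a1 + y *\<^sub>R a2 = 0" for x y
  proof -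
    have "x *\<^sub>R T t + y *\<^sub>R N1 t = 0"
      using Df_comb [of x y] that linear_0 [OF lin [OF w0(1)]] by simp
    then have "lor (x *\<^sub>R T t + y *\<^sub>R N1 t) (T t) = 0" "lor (x *\<^sub>R T t + y *\<^sub>R N1 t) (N1 t) = 0"
      by (simp_all add: lor.zero_left)
    then show ?thesis
      using fr by (simp add: lor.add_left lor.scaleR_left)
  qed
  define W' where "W' = W \<inter> f -` U"
  have W': "open W'" "w0 \<in> W'"
    using continuous_open_preimage [OF smooth_on_continuous_on [OF W(2)] W(1) g(1)] w0 U
    by (auto simp: W'_def)
  have cont: "continuous_on W' (Df a)" "continuous_on W' (DN a)" for a
  proof -
    show D: "continuous_on W' (Df a)"
      unfolding Df_def [abs_def] W'_def
      by (rule continuous_on_subset [OF smooth_on_continuous_on [OF smooth_on_frechet_derivative [OF W(2)]]]) auto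
    show "continuous_on W' (DN a)"
      unfolding DN_def [abs_def]
      by (rule continuous_on_frechet_derivative [OF g(2) continuous_on_subset [OF smooth_on_continuous_on [OF W(2)]]])
         (use D in \<open>auto simp: W'_def\<close>)
  qed
  have line: "((\<lambda>s. f (w0 + s *\<^sub>R a)) has_vector_derivative Df a w0) (at 0)" for a
    using smooth_on_line [OF W(2), of w0 0 a] w0 by (simp add: Df_def)
  have line_ev: "\<forall>\<^sub>F s in nhds 0. P (w0 + s *\<^sub>R a)" if "\<forall>\<^sub>F w in nhds w0. P w" for P a
  proof -
    have "((\<lambda>s. w0 + s *\<^sub>R a) \<longlongrightarrow> w0 + 0 *\<^sub>R a) (nhds (0::real))"
      by (intro tendsto_intros filterlim_ident)
    then have "filterlim (\<lambda>s. w0 + s *\<^sub>R a) (nhds w0) (nhds (0::real))"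
      by simp
    then show ?thesis
      using that by (simp add: filterlim_iff)
  qed
  have ev_W': "\<forall>\<^sub>F w in nhds w0. w \<in> W'"
    using eventually_nhds_in_open [OF W'] .
  have ev_M: "\<forall>\<^sub>F s in nhds 0. f (w0 + s *\<^sub>R a) \<in> M" for a
    using line_ev [OF ev_W'] by (rule eventually_mono) (use W(3) in \<open>auto simp: W'_def\<close>)
  have line_n: "((\<lambda>s. n (f (w0 + s *\<^sub>R a))) has_vector_derivative DN a w0) (at 0)" for a
    using normal_has_vector_derivative [OF g ev_M line] w0 U by (simp add: DN_def)
  \<comment> \<open>Differentiating the orthogonality of the normal and \<open>Df b\<close> in
    direction \<open>a\<close> expresses the second fundamental form by a second derivative of the
    chart, which is symmetric in \<open>a\<close> and \<open>b\<close>.\<close>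
  have second: "lor (DN a w0) (Df b w0) = - lor (\<nu> t) (frechet_derivative (Df b) (at w0) a)" for a b
  proof -
    have "((\<lambda>s. Df b (w0 + s *\<^sub>R a)) has_vector_derivative frechet_derivative (Df b) (at w0) a) (at 0)"
      using smooth_on_line [OF smooth_on_frechet_derivative [OF W(2)], of w0 0 a b] w0
      by (simp add: Df_def [abs_def])
    note der = lor.has_vector_derivative [OF line_n this]
    have "\<forall>\<^sub>F s in nhds 0. lor (n (f (w0 + s *\<^sub>R a))) (Df b (w0 + s *\<^sub>R a)) = 0"
      using line_ev [OF ev_W']
    proof (rule eventually_mono)
      fix s assume "w0 + s *\<^sub>R a \<in> W'"
      then have "Df b (w0 + s *\<^sub>R a) \<in> tangent_plane (f (w0 + s *\<^sub>R a)) (n (f (w0 + s *\<^sub>R a)))"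
        using range unfolding Df_def W'_def by blast
      then show "lor (n (f (w0 + s *\<^sub>R a))) (Df b (w0 + s *\<^sub>R a)) = 0"
        by (simp add: tangent_plane_def lor_commute)
    qed
    from has_vector_derivative_eventually_const [OF der this] show ?thesis
      using w0 by simp
  qed
  have sym: "lor (DN a1 w0) (N1 t) = lor (DN a2 w0) (T t)"
    using second [of a1 a2] second [of a2 a1] a
      frechet_derivative_commute [OF W(1,2) w0(1), of a1 a2] by (simp add: Df_def [abs_def])
  have "DN a1 w0 = \<nu>' t"
    using vector_derivative_at [OF normal_deriv_local [OF t g U]] by (simp add: DN_def w0 a \<nu>'_def)
  then have h: "lor (DN a1 w0) (T t) = - kn t" "lor (DN a1 w0) (N1 t) = - \<tau> t" "lor (DN a2 w0) (T t) = - \<tau> t"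
    using normal_deriv_products(2) [OF t] curvatures(3) [OF t] sym by auto
  define k where "k = kn t"
  define d where "d w = lor (Df a1 w) (Df a1 w) * lor (Df a2 w) (Df a2 w) - lor (Df a1 w) (Df a2 w) * lor (Df a2 w) (Df a1 w)" for w
  define q where "q w = (k * lor (Df a1 w) (Df a1 w) + lor (DN a1 w) (Df a1 w)) * (k * lor (Df a2 w) (Df a2 w) + lor (DN a2 w) (Df a2 w))
     - (k * lor (Df a1 w) (Df a2 w) + lor (DN a1 w) (Df a2 w)) * (k * lor (Df a2 w) (Df a1 w) + lor (DN a2 w) (Df a1 w))" for w
  have d0: "d w0 = 1"
    using fr by (simp add: d_def a)
  \<comment> \<open>The diagonal entry for \<open>T\<close> is \<open>k - kn t = 0\<close>. It
    annihilates the other diagonal entry, which contains the unknown normal curvature along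
    \<open>N1\<close>, and leaves the product of the two equal off-diagonal entries.\<close>
  have q0: "q w0 = - (\<tau> t)\<^sup>2"
    using fr h by (simp add: q_def a k_def power2_eq_square)
  have V: "(f w, k) \<in> V_dom M n" if "w \<in> W'" "d w > 0" "q w \<le> 0" for w
  proof -
    have w: "w \<in> W" "f w \<in> U"
      using that by (auto simp: W'_def)
    show ?thesis
      using that(2,3) unfolding d_def q_def
      by (intro in_V_dom_in_chart [OF W w(1) inj [OF w(1)] range [OF w(1)] g w(2) basis indep])
         (simp_all add: Df_def DN_def)
  qed
  show "(c t, kn t) \<in> V_dom M n"
    using V [OF W'(2)] d0 q0 w0 by (simp add: k_def)
  assume "\<tau> t \<noteq> 0"
  \<comment> \<open>At \<open>w0\<close> the values are 1 and a negative number, so both strict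
    signs persist in a neighbourhood and the path with fixed k stays in
    \<open>V_dom\<close>.\<close>
  have "continuous_on W' d" "continuous_on W' q"
    unfolding d_def [abs_def] q_def [abs_def]
    by (intro continuous_intros lor.continuous_on cont)+
  then have "(d \<longlongrightarrow> d w0) (nhds w0)" "(q \<longlongrightarrow> q w0) (nhds w0)"
    using W' tendsto_at_iff_tendsto_nhds [of d w0] tendsto_at_iff_tendsto_nhds [of q w0]
    by (simp_all add: continuous_on_eq_continuous_at isCont_def)
  then have "\<forall>\<^sub>F w in nhds w0. d w > 0" "\<forall>\<^sub>F w in nhds w0. q w < 0"
    using order_tendstoD(1) [of d "d w0" "nhds w0" 0] order_tendstoD(2) [of q "q w0" "nhds w0" 0]
      d0 q0 \<open>\<tau> t \<noteq> 0\<close> by auto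
  with ev_W' have "\<forall>\<^sub>F w in nhds w0. (f w, k) \<in> V_dom M n"
    by eventually_elim (simp add: V)
  then have ev: "\<forall>\<^sub>F s in nhds 0. (f (w0 + s *\<^sub>R a2), k) \<in> V_dom M n"
    by (rule line_ev)
  \<comment> \<open>The velocity when the contact point moves along \<open>N1\<close> with k fixed.
    Its component along \<open>T\<close> comes from the normal alone and equals
    \<open>- \<tau> t\<close> by symmetry.\<close>
  define w where "w = k *\<^sub>R N1 t + DN a2 w0"
  have "((\<lambda>s. V_map n (f (w0 + s *\<^sub>R a2), k)) has_vector_derivative w) (at 0)"
    unfolding V_map_def w_def split
    by (intro has_vector_derivative_add line_n bounded_linear.has_vector_derivative [OF bounded_linear_scaleR_right])
       (use line [of a2] a in simp)
  moreover have "(\<lambda>s. (f (w0 + s *\<^sub>R a2), k)) differentiable (at 0)"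
    using line [of a2] has_derivative_Pair [OF _ has_derivative_const]
    unfolding has_vector_derivative_def differentiable_def by blast
  ultimately have "w \<in> V_tangent M n (c t, kn t)"
    using ev w0 unfolding V_tangent_def k_def
    by (intro CollectI exI [of _ "\<lambda>s. (f (w0 + s *\<^sub>R a2), kn t)"]) simp
  moreover have "w = - \<tau> t *\<^sub>R T t + lor w (N1 t) *\<^sub>R N1 t"
  proof -
    have "DN a2 w0 \<in> tangent_plane (c t) (\<nu> t)"
      using normal_derivative_tangent [OF ev_M line line_n, of a2] w0 by simp
    then have "w $ 0 = 0" "lor w (c t) = 0" "lor w (\<nu> t) = 0" "lor w (T t) = - \<tau> t"
      using fr h by (auto simp: w_def tangent_plane_def lor.add_left lor.scaleR_left)
    then show ?thesis
      using expansion_I [OF t, of w] by simp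
  qed
  ultimately show "\<exists>y. - \<tau> t *\<^sub>R T t + y *\<^sub>R N1 t \<in> V_tangent M n (c t, kn t)"
    by metis
qed

section \<open>Regularity of the Darboux frame, the torsion and the geodesic curvature\<close>

lemma N1_differentiable:
  assumes t: "t \<in> I"
  shows "\<exists>d. (N1 has_vector_derivative d) (at t)"
proof -
  \<comment> \<open>Removing from the fixed vector \<open>N1 t\<close> its components along the
    other frame vectors at \<open>s\<close> projects it to the line of \<open>N1 s\<close>. This is
    differentiable in \<open>s\<close>, and its normalization is \<open>N1 s\<close> up to
    sign.\<close>
  define Y where "Y s = N1 t - lor (N1 t) (c s) *\<^sub>R (c s - axis 0 1)
    - lor (N1 t) (T s) *\<^sub>R T s - lor (N1 t) (\<nu> s) *\<^sub>R \<nu> s" for s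
  define mat where "mat Z s = (\<chi> i. if i = 0 then axis 0 1 else if i = 1 then c s
    else if i = 2 then T s else if i = 3 then Z s else \<nu> s :: real^5^5)" for Z s
  have Y_eq: "Y s = lor (N1 t) (N1 s) *\<^sub>R N1 s" if "s \<in> I" for s
    using expansion_I [OF that, of "N1 t"] frame_I [OF t] unfolding Y_def
    by (simp add: algebra_simps)
  have det_Y: "det (mat Y s) = lor (N1 t) (N1 s) * det (mat N1 s)" if "s \<in> I" for s
  proof -
    define B where "B i = (if i = 0 then axis 0 1 else if i = 1 then c s
      else if i = 2 then T s else \<nu> s :: real^5)" for i :: 5
    have "mat Z s = (\<chi> i. if i = 3 then Z s else B i)" for Z
      by (simp add: mat_def B_def vec_eq_iff)
    moreover have "Y s = lor (N1 t) (N1 s) *s N1 s"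
      using Y_eq [OF that] by (simp add: scalar_mult_eq_scaleR)
    ultimately show ?thesis
      using det_row_mul [of 3 "lor (N1 t) (N1 s)" "\<lambda>_. N1 s" B] by metis
  qed
  have N1t: "((\<lambda>_. N1 t) has_vector_derivative 0) (at t)"
    by simp
  have e: "((\<lambda>_. axis 0 1 :: real^5) has_vector_derivative 0) (at t)"
    by simp
  note d = derivs [OF t] normal_deriv [OF t]
  have scale: "((\<lambda>s. lor (N1 t) (X s) *\<^sub>R Z s) has_vector_derivative
      lor (N1 t) (X t) *\<^sub>R Z' + lor (N1 t) X' *\<^sub>R Z t) (at t)"
    if "(X has_vector_derivative X') (at t)" "(Z has_vector_derivative Z') (at t)" for X Z :: "real \<Rightarrow> real^5" and X' Z'
    by (rule bounded_bilinear.has_vector_derivative [OF bounded_bilinear_scaleR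
          bounded_linear.has_vector_derivative [OF lor.bounded_linear_right that(1)] that(2)])
  note diff = has_vector_derivative_diff
  have "\<exists>d. (Y has_vector_derivative d) (at t)"
    unfolding Y_def [abs_def]
    using diff [OF diff [OF diff [OF N1t scale [OF d(1) diff [OF d(1) e]]] scale [OF d(2) d(2)]] scale [OF d(4) d(4)]]
    by blast
  then obtain dY where dY: "(Y has_vector_derivative dY) (at t)"
    by blast
  have Yt: "Y t = N1 t"
    using Y_eq [OF t] frame_I [OF t] by simp
  \<comment> \<open>The orientation fixes the sign: the determinant with \<open>Y s\<close> is
    \<open>lor (N1 t) (N1 s)\<close> times the positive one with \<open>N1 s\<close>, and it stays
    positive near \<open>t\<close> by continuity.\<close>
  have "isCont (\<lambda>s. det (mat Y s)) t"
  proof (rule isCont_det)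
    fix i j :: 5
    note cont = has_vector_derivative_continuous [OF d(1)] has_vector_derivative_continuous [OF d(2)]
      has_vector_derivative_continuous [OF d(4)] has_vector_derivative_continuous [OF dY]
    show "isCont (\<lambda>s. mat Y s $ i $ j) t"
      using cont [THEN continuous_component] unfolding mat_def by (cases "i = 0"; cases "i = 1"; cases "i = 2"; cases "i = 3") simp_all
  qed
  moreover have "det (mat Y t) > 0"
    using frame t unfolding darboux_normal_def mat_def Yt by blast
  ultimately have "\<forall>\<^sub>F s in nhds t. det (mat Y s) > 0"
    using order_tendstoD(1) [of "\<lambda>s. det (mat Y s)" "det (mat Y t)" "nhds t" 0]
      tendsto_at_iff_tendsto_nhds [of "\<lambda>s. det (mat Y s)" t] by (simp add: isCont_def)
  with eventually_I [OF t] have ev: "\<forall>\<^sub>F s in nhds t. inverse (sqrt (lor (Y s) (Y s))) *\<^sub>R Y s = N1 s"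
  proof eventually_elim
    fix s assume s: "s \<in> I" "det (mat Y s) > 0"
    define l where "l = lor (N1 t) (N1 s)"
    have "det (mat N1 s) > 0"
      using frame s(1) unfolding darboux_normal_def mat_def by blast
    then have "l > 0"
      using s det_Y [OF s(1)] by (simp add: l_def zero_less_mult_iff)
    moreover have "lor (Y s) (Y s) = l\<^sup>2"
      using frame_I [OF s(1)]
      by (simp add: Y_eq [OF s(1)] l_def lor.scaleR_left lor.scaleR_right power2_eq_square)
    ultimately show "inverse (sqrt (lor (Y s) (Y s))) *\<^sub>R Y s = N1 s"
      using Y_eq [OF s(1)] by (simp add: l_def)
  qed
  have "lor (Y t) (Y t) = 1"
    using Yt frame_I [OF t] by simp
  moreover have "((\<lambda>s. lor (Y s) (Y s)) has_real_derivative lor (Y t) dY + lor dY (Y t)) (at t)"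
    using lor.has_vector_derivative [OF dY dY] by (simp add: has_real_derivative_iff_has_vector_derivative)
  ultimately have "\<exists>l'. ((\<lambda>s. inverse (sqrt (lor (Y s) (Y s)))) has_real_derivative l') (at t)"
    by (intro exI) (auto intro!: derivative_eq_intros)
  then have "\<exists>d. ((\<lambda>s. inverse (sqrt (lor (Y s) (Y s))) *\<^sub>R Y s) has_vector_derivative d) (at t)"
    using has_vector_derivative_scaleR [OF _ dY] by blast
  then show ?thesis
    using has_vector_derivative_cong_ev [of UNIV "\<lambda>s. inverse (sqrt (lor (Y s) (Y s))) *\<^sub>R Y s" N1 t] ev
      eventually_nhds_x_imp_x [OF ev] by auto
qed

definition N1' where "N1' t = vector_derivative N1 (at t)"

lemma N1_deriv: "t \<in> I \<Longrightarrow> (N1 has_vector_derivative N1' t) (at t)"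
  using N1_differentiable unfolding N1'_def by (metis vector_derivative_at)

lemma N1'_eq:
  assumes t: "t \<in> I"
  shows "N1' t = \<tau> t *\<^sub>R \<nu> t - kg t *\<^sub>R T t"
proof -
  have 0: "N1' t $ 0 = 0"
    by (rule constant_on_I [OF nth_has_vector_derivative [OF N1_deriv] t]) (use t frame_I in auto)
  have "lor (N1 t) (T t) + lor (N1' t) (c t) = 0"
    by (rule constant_on_I [OF lor.has_vector_derivative [OF N1_deriv derivs(1)] t]) (use t frame_I in auto)
  moreover have "lor (N1 t) (N1' t) + lor (N1' t) (N1 t) = 0"
    by (rule constant_on_I [OF lor.has_vector_derivative [OF N1_deriv N1_deriv] t]) (use t frame_I in auto)
  moreover have "lor (N1 t) (c2 t) + lor (N1' t) (T t) = 0"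
    by (rule constant_on_I [OF lor.has_vector_derivative [OF N1_deriv derivs(2)] t]) (use t frame_I in auto)
  moreover have "lor (N1 t) (\<nu>' t) + lor (N1' t) (\<nu> t) = 0"
    by (rule constant_on_I [OF lor.has_vector_derivative [OF N1_deriv normal_deriv] t]) (use t frame_I in auto)
  ultimately have "lor (N1' t) (c t) = 0" "lor (N1' t) (N1 t) = 0" "lor (N1' t) (T t) = - kg t"
     "lor (N1' t) (\<nu> t) = \<tau> t"
    using frame_I [OF t] curvatures [OF t] lor_commute [of "N1 t" "N1' t"] lor_commute [of "N1 t" "c2 t"]
      lor_commute [of "N1 t" "\<nu>' t"] by auto
  then show ?thesis
    using expansion_I [OF t, of "N1' t"] 0 by simp
qed

text \<open>The speed of the canonical section is the absolute value of \<tau>, and the arc length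
  parameter asks for a continuous speed.\<close>

lemma continuous_torsion: "continuous_on I \<tau>"
proof -
  have "continuous_on I N1"
    using N1_deriv by (intro continuous_at_imp_continuous_on ballI) (blast intro: has_vector_derivative_continuous)
  then have "continuous_on I (\<lambda>t. - lor (\<nu>' t) (N1 t))"
    by (intro continuous_intros lor.continuous_on continuous_normal_deriv)
  then show ?thesis
    by (simp add: curvatures cong: continuous_on_cong)
qed

lemma kg_deriv:
  assumes t: "t \<in> I"
  shows "(kg has_real_derivative deriv kg t) (at t)"
proof -
  have "\<forall>\<^sub>F s in nhds t. lor (c2 s) (N1 s) = kg s"
    using eventually_I [OF t] by (rule eventually_mono) (simp add: curvatures)
  with lor.has_vector_derivative [OF derivs(3) [OF t] N1_deriv [OF t]]
  have "\<exists>d. (kg has_real_derivative d) (at t)"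
    using has_vector_derivative_cong_ev [of UNIV "\<lambda>s. lor (c2 s) (N1 s)" kg t] eventually_nhds_x_imp_x
    by (fastforce simp: has_real_derivative_iff_has_vector_derivative)
  then show ?thesis
    using DERIV_imp_deriv by blast
qed

section \<open>The canonical section and its geodesic curvature vector\<close>

lemma cansec_eq: "cansec n c t = kn t *\<^sub>R c t + \<nu> t"
  by (simp add: cansec_def cansec_lift_def V_map_def)

lemma cansec_deriv:
  assumes t: "t \<in> I"
  shows "(cansec n c has_vector_derivative deriv kn t *\<^sub>R c t - \<tau> t *\<^sub>R N1 t) (at t)"
proof -
  have "(kn has_real_derivative deriv kn t) (at t)"
    using kn_deriv [OF t] DERIV_imp_deriv by metis
  from has_vector_derivative_add [OF has_vector_derivative_scaleR [OF this derivs(1) [OF t]] normal_deriv [OF t]]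
  show ?thesis
    using normal_deriv_products(3) [OF t]
    unfolding cansec_eq [abs_def] by (simp add: algebra_simps)
qed

lemma spacelike_torsion:
  assumes "spacelike_on (cansec n c) J" "J \<subseteq> I" "t \<in> J"
  shows "\<tau> t \<noteq> 0"
proof
  assume "\<tau> t = 0"
  have t: "t \<in> I"
    using assms by blast
  have "lor (vector_derivative (cansec n c) (at t)) (vector_derivative (cansec n c) (at t)) = 0"
    using frame_I [OF t] \<open>\<tau> t = 0\<close>
    by (simp add: vector_derivative_at [OF cansec_deriv [OF t]] lor.scaleR_left lor.scaleR_right)
  then show False
    using assms unfolding spacelike_on_def by force
qed

lemma geodesic_imp_darboux:
  assumes J: "J \<subseteq> I" "spacelike_on (cansec n c) J"
    and geo: "geodesic_in_V M n (cansec_lift n c) J" and t: "t \<in> J"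
  shows "deriv kn t + \<tau> t * kg t = 0"
proof -
  obtain \<phi> K \<sigma> \<sigma>' \<sigma>'' where H: "open K \<and> is_interval K \<and> bij_betw \<phi> K J \<and>
        (\<forall>s\<in>K. \<phi> differentiable (at s) \<and> deriv \<phi> s > 0) \<and>
        \<sigma> = (\<lambda>s. V_map n (cansec_lift n c (\<phi> s))) \<and>
        (\<forall>s\<in>K. (\<sigma> has_vector_derivative \<sigma>' s) (at s) \<and>
                (\<sigma>' has_vector_derivative \<sigma>'' s) (at s) \<and>
                lor (\<sigma>' s) (\<sigma>' s) = 1 \<and>
                (\<forall>w \<in> V_tangent M n (cansec_lift n c (\<phi> s)). lor (\<sigma>'' s + \<sigma> s) w = 0))"
    using geo unfolding geodesic_in_V_def by (elim conjE exE) (rule that, intro conjI)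
  then have K: "open K" "bij_betw \<phi> K J" and \<sigma>: "\<sigma> = (\<lambda>s. V_map n (cansec_lift n c (\<phi> s)))"
    by blast+
  have \<phi>: "\<phi> differentiable (at s)" "deriv \<phi> s > 0"
    and d: "(\<sigma> has_vector_derivative \<sigma>' s) (at s)" "(\<sigma>' has_vector_derivative \<sigma>'' s) (at s)"
    and unit: "lor (\<sigma>' s) (\<sigma>' s) = 1"
    and geo': "\<And>w. w \<in> V_tangent M n (cansec_lift n c (\<phi> s)) \<Longrightarrow> lor (\<sigma>'' s + \<sigma> s) w = 0"
    if "s \<in> K" for s
    using H that by blast+
  obtain s where s: "s \<in> K" "t = \<phi> s"
    using K(2) t unfolding bij_betw_def by blast
  have \<phi>I: "\<phi> r \<in> I" if "r \<in> K" for r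
    using K(2) J that unfolding bij_betw_def by blast
  have \<sigma>_eq: "\<sigma> r = kn (\<phi> r) *\<^sub>R c (\<phi> r) + \<nu> (\<phi> r)" for r
    by (simp add: \<sigma> cansec_lift_def V_map_def)
  have d\<phi>: "(\<phi> has_vector_derivative deriv \<phi> r) (at r)" if "r \<in> K" for r
    using \<phi>(1) [OF that]
    by (simp only: has_real_derivative_iff_has_vector_derivative [symmetric] DERIV_deriv_iff_real_differentiable)
  have chain: "((\<lambda>r. X (\<phi> r)) has_vector_derivative deriv \<phi> r *\<^sub>R X') (at r)"
    if "r \<in> K" "(X has_vector_derivative X') (at (\<phi> r))" for r and X :: "real \<Rightarrow> real^5" and X'
    using vector_diff_chain_at [OF d\<phi> [OF that(1)] that(2)] by (simp add: o_def)
  have \<sigma>'_eq: "\<sigma>' r = deriv \<phi> r *\<^sub>R (deriv kn (\<phi> r) *\<^sub>R c (\<phi> r) - \<tau> (\<phi> r) *\<^sub>R N1 (\<phi> r))" if "r \<in> K" for r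
  proof -
    have "(\<sigma> has_vector_derivative
      deriv \<phi> r *\<^sub>R (deriv kn (\<phi> r) *\<^sub>R c (\<phi> r) - \<tau> (\<phi> r) *\<^sub>R N1 (\<phi> r))) (at r)"
      using chain [OF that cansec_deriv [OF \<phi>I [OF that]]] by (simp add: \<sigma> cansec_def)
    then show ?thesis
      using d(1) [OF that] vector_derivative_unique_at by blast
  qed
  have const: "e = 0" if "(f has_vector_derivative e) (at s)" "\<And>r. r \<in> K \<Longrightarrow> f r = a"
    for f :: "real \<Rightarrow> real" and e a
    by (rule has_vector_derivative_eventually_const
          [OF that(1) eventually_mono [OF eventually_nhds_in_open [OF K(1) s(1)] that(2)]])
  have t': "t \<in> I"
    using t J by blast
  note fr = frame_I [OF t']
  note bil = lor.add_left lor.diff_left lor.scaleR_left lor.add_right lor.diff_right lor.scaleR_right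
  define a where "a = deriv \<phi> s"
  have a: "a > 0"
    using \<phi> s(1) by (simp add: a_def)
  have \<sigma>'_t: "\<sigma>' s = a *\<^sub>R (deriv kn t *\<^sub>R c t - \<tau> t *\<^sub>R N1 t)"
    using \<sigma>'_eq [OF s(1)] by (simp add: a_def s(2))
  have "lor (\<sigma>' s) (a *\<^sub>R c2 t) + lor (\<sigma>'' s) (T t) = 0"
    unfolding a_def s(2)
    by (rule const [where a=0, OF lor.has_vector_derivative [OF d(2) chain [OF _ derivs(2)]]])
       (use s \<phi>I frame_I in \<open>auto simp: \<sigma>'_eq bil\<close>)
  \<comment> \<open>One factor \<open>a\<close> comes from \<open>\<sigma>'\<close>, the other from
    the chain rule for \<open>T\<close> along \<phi>.\<close>
  moreover have "lor (\<sigma>' s) (a *\<^sub>R c2 t) = - (a * a * (deriv kn t + \<tau> t * kg t))"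
    using c2_products [OF t'] curvatures(2) [OF t']
    by (simp add: \<sigma>'_t bil lor_commute [of _ "c2 t"] algebra_simps)
  ultimately have T: "lor (\<sigma>'' s) (T t) = a * a * (deriv kn t + \<tau> t * kg t)"
    by linarith
  have "lor (\<sigma>' s) (a *\<^sub>R T t) + lor (\<sigma>'' s) (c t) = 0"
    unfolding a_def s(2)
    by (rule const [where a=0, OF lor.has_vector_derivative [OF d(2) chain [OF _ derivs(1)]]])
       (use s \<phi>I frame_I in \<open>auto simp: \<sigma>'_eq bil\<close>)
  then have c: "lor (\<sigma>'' s) (c t) = 0"
    using fr by (simp add: \<sigma>'_t bil)
  have "lor (\<sigma>' s) (\<sigma>'' s) + lor (\<sigma>'' s) (\<sigma>' s) = 0"
    by (rule const [where a=1, OF lor.has_vector_derivative [OF d(2) d(2)]]) (use s unit in auto)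
  then have "lor (\<sigma>'' s) (\<sigma>' s) = 0"
    by (simp add: lor_commute)
  then have N1: "\<tau> t * lor (\<sigma>'' s) (N1 t) = 0"
    using a c by (simp add: \<sigma>'_t bil)
  have \<tau>: "\<tau> t \<noteq> 0"
    using spacelike_torsion J t by blast
  \<comment> \<open>The coefficient \<open>y\<close> is unknown but harmless:
    \<open>\<sigma>''\<close> has no component along \<open>N1\<close>, and
    \<open>\<sigma> s\<close> is orthogonal to both \<open>T t\<close> and
    \<open>N1 t\<close>.\<close>
  obtain y where "- \<tau> t *\<^sub>R T t + y *\<^sub>R N1 t \<in> V_tangent M n (c t, kn t)"
    using shape_operator(2) [OF t' \<tau>] by blast
  then have "lor (\<sigma>'' s + \<sigma> s) (- \<tau> t *\<^sub>R T t + y *\<^sub>R N1 t) = 0"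
    using geo' [OF s(1)] by (simp add: s(2) cansec_lift_def)
  moreover have "lor (\<sigma> s) (- \<tau> t *\<^sub>R T t + y *\<^sub>R N1 t) = 0"
    unfolding \<sigma>_eq s(2) [symmetric] using fr by (simp add: bil lor.minus_right)
  ultimately have "\<tau> t * lor (\<sigma>'' s) (T t) = 0"
    using N1 \<tau> by (simp add: bil lor.minus_right)
  then show ?thesis
    using T a \<tau> by simp
qed

text \<open>Inserting the equation in the velocity of the section gives \<tau> times
  \<open>- kg t *\<^sub>R c t - N1 t\<close>. Division by the speed leaves only the sign of \<tau>,
  so the second derivative involves those of \<open>kg\<close>, \<open>c\<close> and
  \<open>N1\<close> but none of \<tau>.\<close>

lemma darboux_imp_geodesic:
  assumes J: "open J" "is_interval J" "J \<subseteq> I" "spacelike_on (cansec n c) J"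
    and dbx: "\<And>t. t \<in> J \<Longrightarrow> deriv kn t + \<tau> t * kg t = 0"
  shows "geodesic_in_V M n (cansec_lift n c) J"
proof -
  note bil = lor.add_left lor.diff_left lor.scaleR_left lor.add_right lor.diff_right lor.scaleR_right
  have \<tau>: "\<tau> t \<noteq> 0" if "t \<in> J" for t
    using spacelike_torsion J that by blast
  have c\<tau>: "continuous_on J \<tau>"
    using continuous_torsion continuous_on_subset J by blast
  obtain \<phi> K where K: "open K" "is_interval K" "bij_betw \<phi> K J"
    and \<phi>: "\<And>s. s \<in> K \<Longrightarrow> (\<phi> has_real_derivative inverse \<bar>\<tau> (\<phi> s)\<bar>) (at s)"
    using arc_length_parameter [OF J(1,2), of "\<lambda>t. \<bar>\<tau> t\<bar>"] c\<tau> \<tau>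
    by (metis continuous_on_rabs zero_less_abs_iff)
  have \<phi>J: "\<phi> s \<in> J" if "s \<in> K" for s
    using K(3) that unfolding bij_betw_def by blast
  then have \<phi>I: "\<phi> s \<in> I" if "s \<in> K" for s
    using J that by blast
  have chain: "((\<lambda>r. X (\<phi> r)) has_vector_derivative inverse \<bar>\<tau> (\<phi> s)\<bar> *\<^sub>R X') (at s)"
    if "s \<in> K" "(X has_vector_derivative X') (at (\<phi> s))" for s and X :: "real \<Rightarrow> real^5" and X'
    using vector_diff_chain_at [OF \<phi> [OF that(1), unfolded has_real_derivative_iff_has_vector_derivative] that(2)]
    by (simp add: o_def)
  define \<sigma> where "\<sigma> s = V_map n (cansec_lift n c (\<phi> s))" for s
  define Z where "Z e t = e *\<^sub>R (- kg t *\<^sub>R c t - N1 t)" for e t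
  define \<sigma>' where "\<sigma>' s = Z (sgn (\<tau> (\<phi> s))) (\<phi> s)" for s
  \<comment> \<open>In the derivative of \<open>- kg t *\<^sub>R c t - N1 t\<close> the two terms
    along \<open>T\<close> cancel. The remaining term \<open>- \<nu>\<close> cancels the normal part
    of \<sigma>, which leaves a multiple of \<open>c\<close> as geodesic curvature vector.\<close>
  define \<sigma>'' where "\<sigma>'' s = - (deriv kg (\<phi> s) / \<tau> (\<phi> s)) *\<^sub>R c (\<phi> s) - \<nu> (\<phi> s)" for s
  have "(\<sigma> has_vector_derivative \<sigma>' s) (at s)" if s: "s \<in> K" for s
  proof -
    define t where "t = \<phi> s"
    have kn': "deriv kn t = - \<tau> t * kg t"
      using dbx [OF \<phi>J [OF s]] by (simp add: t_def)
    have "inverse \<bar>\<tau> t\<bar> *\<^sub>R (deriv kn t *\<^sub>R c t - \<tau> t *\<^sub>R N1 t) = Z (inverse \<bar>\<tau> t\<bar> * \<tau> t) t"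
      by (simp add: kn' Z_def algebra_simps)
    also have "inverse \<bar>\<tau> t\<bar> * \<tau> t = sgn (\<tau> t)"
      by (simp add: sgn_div_norm real_sgn_eq divide_inverse mult.commute)
    finally show ?thesis
      using chain [OF s cansec_deriv [OF \<phi>I [OF s]]]
      by (simp add: \<sigma>_def [abs_def] \<sigma>'_def cansec_def t_def)
  qed
  moreover have "(\<sigma>' has_vector_derivative \<sigma>'' s) (at s)" if s: "s \<in> K" for s
  proof -
    define t where "t = \<phi> s"
    have t: "t \<in> I" "t \<in> J"
      using \<phi>I \<phi>J s by (auto simp: t_def)
    \<comment> \<open>\<tau> is continuous and nowhere zero on \<open>J\<close>, so its sign is
      locally constant and can be frozen before differentiating.\<close>
    define e where "e = sgn (\<tau> t)"
    have "isCont \<tau> t"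
      using c\<tau> J(1) t by (simp add: continuous_on_eq_continuous_at)
    then have "isCont (\<lambda>r. \<tau> (\<phi> r)) s"
      using DERIV_isCont [OF \<phi> [OF s]] isCont_o2 unfolding t_def by blast
    then have lim: "((\<lambda>r. \<tau> (\<phi> r)) \<longlongrightarrow> \<tau> t) (nhds s)"
      using tendsto_at_iff_tendsto_nhds [of "\<lambda>r. \<tau> (\<phi> r)" s] by (simp add: isCont_def t_def)
    have "\<forall>\<^sub>F r in nhds s. sgn (\<tau> (\<phi> r)) = e"
    proof (cases "\<tau> t > 0")
      case True
      then show ?thesis
        using order_tendstoD(1) [OF lim True] by (auto simp: e_def elim: eventually_mono)
    next
      case False
      then have "\<tau> t < 0"
        using \<tau> [OF t(2)] by simp
      then show ?thesis
        using order_tendstoD(2) [OF lim \<open>\<tau> t < 0\<close>] by (auto simp: e_def elim: eventually_mono)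
    qed
    then have ev: "\<forall>\<^sub>F r in nhds s. Z e (\<phi> r) = \<sigma>' r"
      by (rule eventually_mono) (simp add: \<sigma>'_def)
    have "((\<lambda>t. - kg t) has_real_derivative - deriv kg t) (at t)"
      using kg_deriv [OF t(1)] by (rule DERIV_minus)
    from has_vector_derivative_diff [OF has_vector_derivative_scaleR [OF this derivs(1) [OF t(1)]] N1_deriv [OF t(1)]]
    have "(Z e has_vector_derivative e *\<^sub>R (- deriv kg t *\<^sub>R c t - \<tau> t *\<^sub>R \<nu> t)) (at t)"
      unfolding Z_def [abs_def]
      by (intro bounded_linear.has_vector_derivative [OF bounded_linear_scaleR_right])
         (simp add: N1'_eq [OF t(1)] algebra_simps)
    from chain [OF s this [unfolded t_def]]
    have "((\<lambda>r. Z e (\<phi> r)) has_vector_derivative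
        inverse \<bar>\<tau> t\<bar> *\<^sub>R e *\<^sub>R (- deriv kg t *\<^sub>R c t - \<tau> t *\<^sub>R \<nu> t)) (at s)"
      by (simp add: t_def)
    moreover have "inverse \<bar>\<tau> t\<bar> * e = inverse (\<tau> t)"
      using \<tau> [OF t(2)] by (simp add: e_def sgn_if)
    then have "inverse \<bar>\<tau> t\<bar> *\<^sub>R e *\<^sub>R (- deriv kg t *\<^sub>R c t - \<tau> t *\<^sub>R \<nu> t) = \<sigma>'' s"
      using \<tau> [OF t(2)]
      by (simp only: scaleR_scaleR)
         (simp add: \<sigma>''_def t_def [symmetric] scaleR_diff_right divide_inverse mult.commute)
    ultimately show ?thesis
      using has_vector_derivative_cong_ev [of UNIV "\<lambda>r. Z e (\<phi> r)" \<sigma>' s] ev eventually_nhds_x_imp_x [OF ev]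
      by auto
  qed
  moreover have "lor (\<sigma>' s) (\<sigma>' s) = 1" if s: "s \<in> K" for s
    using frame_I [OF \<phi>I [OF s]] \<tau> [OF \<phi>J [OF s]]
    by (simp add: \<sigma>'_def Z_def bil lor.minus_left lor.minus_right sgn_if)
  moreover have "lor (\<sigma>'' s + \<sigma> s) w = 0"
    if s: "s \<in> K" and w: "w \<in> V_tangent M n (cansec_lift n c (\<phi> s))" for s w
  proof -
    have "\<sigma>'' s + \<sigma> s = (kn (\<phi> s) - deriv kg (\<phi> s) / \<tau> (\<phi> s)) *\<^sub>R c (\<phi> s)"
      by (simp add: \<sigma>''_def \<sigma>_def cansec_lift_def V_map_def algebra_simps)
    then show ?thesis
      using V_tangent_orthogonal w by (simp add: lor.scaleR_left cansec_lift_def)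
  qed
  moreover have "\<phi> differentiable (at s) \<and> deriv \<phi> s > 0" if s: "s \<in> K" for s
    using \<phi> [OF s] \<tau> [OF \<phi>J [OF s]] DERIV_imp_deriv [OF \<phi> [OF s]]
    by (auto simp: real_differentiable_def)
  moreover have "cansec_lift n c t \<in> V_dom M n" if "t \<in> J" for t
    using shape_operator(1) J that by (auto simp: cansec_lift_def)
  ultimately show ?thesis
    unfolding geodesic_in_V_def using K \<sigma>_def
    by (intro conjI ballI exI [of _ \<phi>] exI [of _ K] exI [of _ \<sigma>] exI [of _ \<sigma>'] exI [of _ \<sigma>'']) auto
qed

end

text \<open>Both \<open>darboux_curve\<close> and the equation are conditions at each single point,
  so they restrict to the intervals \<open>J\<close> on which arc length of the section makes sense.
  If the section is space-like throughout, \<open>J = I\<close> gives the equivalence for the whole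
  curve.\<close>

theorem theorem10:
  fixes M :: "(real^5) set"
    and n :: "real^5 \<Rightarrow> real^5"
    and c N1 :: "real \<Rightarrow> real^5"
    and I :: "real set"
  assumes "smooth_surface M"
    and "unit_normal_field M n"
    and "unit_speed_curve M c I"
    and "darboux_normal M n c I N1"
  shows "(darboux_curve M c I \<longleftrightarrow>
            (\<forall>t\<in>I. deriv (normal_curvature n c) t
                    + geodesic_torsion n c N1 t * geodesic_curvature c N1 t = 0)) \<and>
         (\<forall>J. open J \<and> is_interval J \<and> J \<subseteq> I \<and> spacelike_on (cansec n c) J \<longrightarrow>
            (darboux_curve M c J \<longleftrightarrow> geodesic_in_V M n (cansec_lift n c) J))"
proof -
  interpret surface_curve M n c N1 I
    using assms by unfold_locales
  show ?thesis
  proof (intro conjI allI impI)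
    show "darboux_curve M c I \<longleftrightarrow> (\<forall>t\<in>I. deriv kn t + \<tau> t * kg t = 0)"
      by (rule darboux_curve_iff) simp
    fix J assume J: "open J \<and> is_interval J \<and> J \<subseteq> I \<and> spacelike_on (cansec n c) J"
    then have "darboux_curve M c J \<longleftrightarrow> (\<forall>t\<in>J. deriv kn t + \<tau> t * kg t = 0)"
      by (intro darboux_curve_iff) simp
    then show "darboux_curve M c J \<longleftrightarrow> geodesic_in_V M n (cansec_lift n c) J"
      using J darboux_imp_geodesic [of J] geodesic_imp_darboux [of J] by blast
  qed
qed

end
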